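(* Let $U\subseteq\mathbb{H}^n$ be open and $1\le k\le 2n+1$. If $T\in\mathcal{R}_{\mathbb{H}\text{-rect},k}(U)$ then $M(T)<\infty$, i.e. $\mathcal{R}_{\mathbb{H}\text{-rect},k}(U)\subseteq R_{\mathbb{H},k}(U)$. Consequently also $I_{\mathbb{H}\text{-rect},k}(U)\subseteq N_{\mathbb{H},k}(U)$.
   Context: **Heisenberg group.** For $n\ge 1$, $\mathbb{H}^n=(\mathbb{R}^{2n+1},* )$ with coordinates $(x,y,\tau)$, $x,y\in\mathbb{R}^n$, $\tau\in\mathbb{R}$, and $(x,y,\tau)*(x',y',\tau')=(x+x',y+y',\tau+\tau'+\frac12\sum_j(x_jy_j'-y_jx_j'))$, with dilations $\delta_r(x,y,\tau)=(rx,ry,r^2\tau)$. Left invariant fields: $W_j=\partial_{x_j}-\frac12y_j\partial_\tau$, $W_{n+j}=\partial_{y_j}+\frac12x_j\partial_\tau$ ($1\le j\le n$), $W_{2n+1}=\partial_\tau$, declared orthonormal; they span the Lie algebra $\mathfrak{h}$, and $\mathfrak{h}_1=\operatorname{span}\{W_1,\dots,W_{2n}\}$. Dual basis: $dw_j=dx_j$, $dw_{n+j}=dy_j$, $dw_{2n+1}=\theta:=d\tau-\frac12\sum_j(x_jdy_j-y_jdx_j)$. $\langle\omega|v\rangle$ is the pairing of $k$-covectors and $k$-vectors, which carry the induced inner products and norms $|\cdot|$; $*$ is the Hodge operator on multivectors of $\mathfrak{h}$. **Rumin forms and currents.** $\Omega^k$: smooth $k$-forms; $I^k=\{\alpha\wedge\theta+\beta\wedge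 d\theta:\alpha\in\Omega^{k-1},\beta\in\Omega^{k-2}\}$; $J^k=\{\alpha\in\Omega^k:\alpha\wedge\theta=0,\alpha\wedge d\theta=0\}$. $\mathcal{D}^k_{\mathbb{H}}(U)$: compactly supported smooth sections on $U$ of $\Omega^k/I^k$ if $k\le n$ (for $k=0$: $C_c^\infty(U)$), of $J^k$ if $k\ge n+1$. $\mathcal{D}_{\mathbb{H},k}(U)$: continuous linear functionals on $\mathcal{D}^k_{\mathbb{H}}(U)$. The Rumin differential $d_c$ is: $d_c[\alpha]_{I^k}=[d\alpha]_{I^{k+1}}$ for $k<n$; $d_c=d$ on $J^k$ for $k\ge n+1$; and for $k=n$, $d_c[\alpha]_{I^n}=D[\alpha]_{I^n}=d(\alpha+\mathcal{L}(\alpha)\wedge\theta)$, where $\mathcal{L}(\alpha)=L^{-1}(-(d\alpha)_{|\bigwedge^{n+1}\mathfrak{h}_1})$, $L:\bigwedge^{n-1}\mathfrak{h}_1\to\bigwedge^{n+1}\mathfrak{h}_1$ is the isomorphism $\beta\mapsto d\theta\wedge\beta$, and $(\cdot)_{|\bigwedge^{n+1}\mathfrak{h}_1}$ is the component not containing $\theta$. Boundary: $\partial T(\omega)=T(d_c\omega)$ ($\partial T=0$ for $0$-currents). $\operatorname{spt}T$ is the complement in $U$ of the union of all open $V\subseteq U$ such that $T(\omega)=0$ whenever $\operatorname{spt}\omega\subseteq V$. **Mass and spaces.** For $k\le n$, a simple $v=v_1\wedge\dots\wedge v_k\in\bigwedge_k\mathfrak{h}_1$ is integrable if the distribution spanned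 by the left invariant fields $v_1,\dots,v_k$ is integrable; for $k\ge n+1$ a $k$-vector is called simple integrable here if it is $*v$ with $v\in\bigwedge_{2n+1-k}\mathfrak{h}_1$ simple and integrable. ${}_H\bigwedge_k$ is the linear span of the simple integrable $k$-vectors (for $k\le n$ they annihilate $I^k$, so the pairing with $\Omega^k/I^k$ is well defined). $\|\omega(p)\|^*=\sup\{\langle\omega(p)|v\rangle: v\text{ a unit simple integrable }k\text{-vector}\}$, $M(T)=\sup\{T(\omega):\omega\in\mathcal{D}^k_{\mathbb{H}}(U),\|\omega(p)\|^*\le1\ \forall p\}$. $\mathcal{E}_{\mathbb{H},k}(U)$: currents with compact support; $R_{\mathbb{H},k}(U)=\{T\in\mathcal{E}_{\mathbb{H},k}(U):M(T)<\infty\}$; $N_{\mathbb{H},k}(U)=\{T\in\mathcal{E}_{\mathbb{H},k}(U):M(T)+M(\partial T)<\infty\}$. **Rectifiable sets.** $C^1_{\mathbb{H}}$ denotes continuous maps between open subsets of Carnot groups with continuous Pansu differential $d_H$; for real $f$, $\nabla_{\mathbb{H}}f=\sum_{j\le2n}(W_jf)W_j$. For $1\le k\le n$: $S\subseteq\mathbb{H}^n$ is an $\mathbb{H}$-regular $k$-dimensional surface if every $p\in S$ has a neighbourhood $V$ with $S\cap V=\varphi(A)$, $A\subseteq\mathbb{R}^k$ open, $\varphi\in C^1_{\mathbb{H}}(A,V)$ injective with $d_H\varphi$ injective; $S$ is an $\mathbb{H}$-regular $k$-codimensional surface (dimension $2n+1-k$) if every $p\in S$ has a neighbourhood $V$ and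 $f\in C^1_{\mathbb{H}}(V,\mathbb{R}^k)$ with $\nabla_{\mathbb{H}}f_1\wedge\dots\wedge\nabla_{\mathbb{H}}f_k\ne0$ on $V$ and $S\cap V=\{f=0\}$. Let $\mathcal{S}^m_\infty$ be the $m$-dimensional spherical Hausdorff measure for the distance $d_\infty(p,q)=\|p^{-1}*q\|_\infty$, $\|(x,y,\tau)\|_\infty=\max\{|(x,y)|,|\tau|^{1/2}\}$, and put $\mu_k=\mathcal{S}^k_\infty$ if $1\le k\le n$, $\mu_k=\mathcal{S}^{k+1}_\infty$ if $n+1\le k\le2n+1$. A set $S$ is $k$-dimensional $\mathbb{H}$-rectifiable if it is $\mu_k$-measurable, $\mu_k(S)<\infty$, and $S\subseteq S_0\cup\bigcup_{j\ge1}S_j$ with $\mu_k(S_0)=0$ and $S_j$ $\mathbb{H}$-regular surfaces of dimension $k$ ($k$-dimensional surfaces if $k\le n$, $(2n+1-k)$-codimensional surfaces if $k\ge n+1$). Such a set can be written, up to a null set, as a disjoint union of Borel subsets of the $S_j$, and is oriented through orientations of these pieces. **Rectifiable currents.** $\mathcal{R}_{\mathbb{H}\text{-rect},k}(U)$ is the set of $T\in\mathcal{E}_{\mathbb{H},k}(U)$ of the form $T(\omega)=\int_{U_T}\langle\omega(p)|\overrightarrow{T}(p)\rangle\rho(p)\,d\mu_k$ for all $\omega\in\mathcal{D}^k_{\mathbb{H}}(U)$, where $U_T\subseteq U$ is a $k$-dimensional $\mathbb{H}$-rectifiable set oriented, up to a null set, by $\overrightarrow{T}$, which is $\mu_k$-a.e.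 a unit simple tangent $k$-vector in ${}_H\bigwedge_k$, and $\rho$ is a positive integer valued multiplicity with $\int_{U_T\cap\operatorname{spt}T}\rho\,d\mu_k<\infty$. $I_{\mathbb{H}\text{-rect},k}(U)=\{T\in\mathcal{R}_{\mathbb{H}\text{-rect},k}(U):\partial T\in\mathcal{R}_{\mathbb{H}\text{-rect},k-1}(U)\}$; for $k=1$, $\mathcal{R}_{\mathbb{H}\text{-rect},0}(U)$ is the set of finite integer combinations of point evaluations.
   Formalization: In degree n the Rumin differential is taken as d(α + θ∧L(α)) instead of d(α + L(α)∧θ); these agree for odd n, while for even n the printed formula is not well defined on Ω^n/I^n and does not take values in J^{n+1}. *)

theory Defs
  imports "HOL-Analysis.Analysis"
begin

section \<open>The Heisenberg group and its Lie algebra\<close>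

text \<open>Coordinates are indexed by a finite type with \<open>2n+1\<close> elements, where \<open>n = CARD('n)\<close>:
  \<open>Xc j\<close>, \<open>Yc j\<close>, \<open>Tc\<close> stand for the coordinates \<open>x\<^sub>j\<close>, \<open>y\<^sub>j\<close>, \<open>\<tau>\<close>, and at the same time for
  the basis elements \<open>W\<^sub>j\<close>, \<open>W\<^bsub>n+j\<^esub>\<close>, \<open>W\<^bsub>2n+1\<^esub>\<close> of the Lie algebra.\<close>

datatype 'n hidx = Xc 'n | Yc 'n | Tc

lemma UNIV_hidx: "(UNIV :: 'n hidx set) = insert Tc (range Xc \<union> range Yc)"
proof -
  have "i \<in> insert Tc (range Xc \<union> range Yc)" for i :: "'n hidx"
    by (cases i) auto
  then show ?thesis by blast
qed

instance hidx :: (finite) finite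
  by standard (simp add: UNIV_hidx)

text \<open>The type of points, and also of elements of the Lie algebra \<open>\<hh>\<close> written in the basis
  \<open>W\<^sub>1, \<dots>, W\<^bsub>2n+1\<^esub>\<close>; the Euclidean structure of the type makes this basis orthonormal. In these
  coordinates the exponential map is the identity.\<close>

type_synonym 'n heis = "real ^ ('n hidx)"

definition hmult :: "'n::finite heis \<Rightarrow> 'n heis \<Rightarrow> 'n heis" where
  "hmult p q = (\<chi> i. case i of
       Xc j \<Rightarrow> p $ Xc j + q $ Xc j
     | Yc j \<Rightarrow> p $ Yc j + q $ Yc j
     | Tc \<Rightarrow> p $ Tc + q $ Tc + (\<Sum>j\<in>UNIV. p $ Xc j * q $ Yc j - p $ Yc j * q $ Xc j) / 2)"

definition hdil :: "real \<Rightarrow> 'n::finite heis \<Rightarrow> 'n heis" where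
  "hdil r p = (\<chi> i. case i of Xc j \<Rightarrow> r * p $ Xc j | Yc j \<Rightarrow> r * p $ Yc j | Tc \<Rightarrow> r\<^sup>2 * p $ Tc)"

definition hnorm :: "'n::finite heis \<Rightarrow> real" where
  "hnorm p = max (sqrt (\<Sum>j\<in>UNIV. (p $ Xc j)\<^sup>2 + (p $ Yc j)\<^sup>2)) (sqrt \<bar>p $ Tc\<bar>)"

text \<open>The inverse of \<open>p\<close> in the group is \<open>- p\<close>.\<close>

definition hdist :: "'n::finite heis \<Rightarrow> 'n heis \<Rightarrow> real" where
  "hdist p q = hnorm (hmult (- p) q)"

fun Wfield :: "'n::finite hidx \<Rightarrow> 'n heis \<Rightarrow> 'n heis" where
  "Wfield (Xc j) p = axis (Xc j) 1 - (p $ Yc j / 2) *\<^sub>R axis Tc 1"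
| "Wfield (Yc j) p = axis (Yc j) 1 + (p $ Xc j / 2) *\<^sub>R axis Tc 1"
| "Wfield Tc p = axis Tc 1"

definition left_field :: "'n::finite heis \<Rightarrow> 'n heis \<Rightarrow> 'n heis" where
  "left_field w p = (\<Sum>i\<in>UNIV. w $ i *\<^sub>R Wfield i p)"

text \<open>The action of \<open>W\<^sub>i\<close> on functions, as a directional derivative. The line \<open>t \<mapsto> p + t W\<^sub>i(p)\<close> is
  the integral curve of \<open>W\<^sub>i\<close> through \<open>p\<close>, so this is also the right notion for functions that are
  differentiable in horizontal directions only.\<close>

definition Wderiv :: "'n::finite hidx \<Rightarrow> ('n heis \<Rightarrow> 'b::real_normed_vector) \<Rightarrow> 'n heis \<Rightarrow> 'b" where
  "Wderiv i f p = vector_derivative (\<lambda>t. f (p + t *\<^sub>R Wfield i p)) (at 0)"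

definition horizontal_layer :: "'n::finite heis set" where
  "horizontal_layer = {w. w $ Tc = 0}"

definition hgrad :: "('n::finite heis \<Rightarrow> real) \<Rightarrow> 'n heis \<Rightarrow> 'n heis" where
  "hgrad f p = (\<chi> i. if i = Tc then 0 else Wderiv i f p)"


section \<open>Multivectors and multicovectors\<close>

text \<open>\<open>\<And>\<^sub>* \<hh>\<close> and \<open>\<And>\<^sup>* \<hh>\<close> are both modelled by the coefficients with respect to the bases
  \<open>W\<^sub>I = W\<^bsub>i\<^sub>1\<^esub> \<and> \<dots> \<and> W\<^bsub>i\<^sub>k\<^esub>\<close> and \<open>dw\<^sub>I\<close> (\<open>i\<^sub>1 < \<dots> < i\<^sub>k\<close> the elements of \<open>I\<close>). These bases are
  orthonormal for the induced inner products and dual to each other, so the inner product of the type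
  is both the induced inner product and the pairing \<open>\<langle>\<omega>|v\<rangle>\<close>.\<close>

type_synonym 'n mvec = "real ^ ('n hidx set)"

text \<open>Any numbering of the index type by \<open>0, \<dots>, n - 1\<close>; it only serves to order the basis
  as \<open>W\<^sub>1, \<dots>, W\<^bsub>2n+1\<^esub>\<close>.\<close>

definition coord_no :: "'n::finite \<Rightarrow> nat" where
  "coord_no = (SOME f. bij_betw f UNIV {..<CARD('n)})"

fun hpos :: "'n::finite hidx \<Rightarrow> nat" where
  "hpos (Xc j) = coord_no j"
| "hpos (Yc j) = CARD('n) + coord_no j"
| "hpos Tc = 2 * CARD('n)"

definition shuffle_sign :: "'n::finite hidx set \<Rightarrow> 'n hidx set \<Rightarrow> real" where
  "shuffle_sign I J = (- 1) ^ card {(i, j). i \<in> I \<and> j \<in> J \<and> hpos j < hpos i}"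

definition wedge :: "'n::finite mvec \<Rightarrow> 'n mvec \<Rightarrow> 'n mvec"  (infixr "\<and>\<^sub>w" 75) where
  "a \<and>\<^sub>w b = (\<chi> K. \<Sum>I\<in>Pow K. shuffle_sign I (K - I) * (a $ I * b $ (K - I)))"

definition ext_one :: "'n::finite mvec" where
  "ext_one = axis {} 1"

definition vec1 :: "'n::finite heis \<Rightarrow> 'n mvec" where
  "vec1 w = (\<Sum>i\<in>UNIV. w $ i *\<^sub>R axis {i} 1)"

definition wedge_list :: "'n::finite heis list \<Rightarrow> 'n mvec" where
  "wedge_list ws = foldr (\<and>\<^sub>w) (map vec1 ws) ext_one"

text \<open>The degree is an integer, so that the spaces of degree \<open>k - 1\<close> and \<open>k - 2\<close>
  are zero when this is negative.\<close>

definition homog :: "int \<Rightarrow> 'n::finite mvec \<Rightarrow> bool" where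
  "homog k a \<longleftrightarrow> (\<forall>I. a $ I \<noteq> 0 \<longrightarrow> int (card I) = k)"

text \<open>The Hodge operator: \<open>*W\<^sub>I = \<sigma> W\<^bsub>- I\<^esub>\<close> with the sign for which
  \<open>W\<^sub>I \<and> *W\<^sub>I = W\<^sub>1 \<and> \<dots> \<and> W\<^bsub>2n+1\<^esub>\<close>, extended linearly.\<close>

definition hodge :: "'n::finite mvec \<Rightarrow> 'n mvec" where
  "hodge v = (\<chi> K. shuffle_sign (- K) K * v $ (- K))"

definition dw :: "'n::finite hidx \<Rightarrow> 'n mvec" where
  "dw i = axis {i} 1"

definition theta :: "'n::finite mvec" where
  "theta = dw Tc"

text \<open>From \<open>\<theta> = d\<tau> - 1/2 \<Sum>\<^sub>j (x\<^sub>j dy\<^sub>j - y\<^sub>j dx\<^sub>j)\<close>: \<open>d\<theta> = - \<Sum>\<^sub>j dx\<^sub>j \<and> dy\<^sub>j\<close>.\<close>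

definition dtheta :: "'n::finite mvec" where
  "dtheta = - (\<Sum>j\<in>UNIV. dw (Xc j) \<and>\<^sub>w dw (Yc j))"

definition horizontal_cov :: "'n::finite mvec \<Rightarrow> bool" where
  "horizontal_cov a \<longleftrightarrow> (\<forall>I. Tc \<in> I \<longrightarrow> a $ I = 0)"

definition horizontal_part :: "'n::finite mvec \<Rightarrow> 'n mvec" where
  "horizontal_part a = (\<chi> I. if Tc \<in> I then 0 else a $ I)"

text \<open>Interior product with \<open>W\<^bsub>2n+1\<^esub>\<close>: \<open>\<theta> \<and> dw\<^sub>I \<mapsto> dw\<^sub>I\<close> and \<open>dw\<^sub>I \<mapsto> 0\<close> if \<open>Tc \<notin> I\<close>.\<close>

definition contract_T :: "'n::finite mvec \<Rightarrow> 'n mvec" where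
  "contract_T a = (\<chi> I. if Tc \<in> I then 0 else shuffle_sign {Tc} I * a $ insert Tc I)"


section \<open>Smooth forms and the exterior derivative\<close>

fun iter_deriv :: "'a list \<Rightarrow> ('a::real_normed_vector \<Rightarrow> 'b::real_normed_vector) \<Rightarrow> 'a \<Rightarrow> 'b" where
  "iter_deriv [] f = f"
| "iter_deriv (v # vs) f = (\<lambda>p. frechet_derivative (iter_deriv vs f) (at p) v)"

text \<open>\<open>C\<^sup>\<infinity>\<close> on an open set: all iterated partial derivatives exist and are differentiable.\<close>

definition smooth_on :: "'a::euclidean_space set \<Rightarrow> ('a \<Rightarrow> 'b::real_normed_vector) \<Rightarrow> bool" where
  "smooth_on U f \<longleftrightarrow>
     (\<forall>vs. set vs \<subseteq> Basis \<longrightarrow> (\<forall>p\<in>U. iter_deriv vs f differentiable (at p)))"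

text \<open>A differential form is given by its coefficients in the left invariant coframe \<open>dw\<^sub>I\<close>.
  Values outside \<open>U\<close> are irrelevant.\<close>

type_synonym 'n form = "'n heis \<Rightarrow> 'n mvec"

definition forms :: "int \<Rightarrow> 'n::finite heis set \<Rightarrow> 'n form set" where
  "forms k U = {\<alpha>. smooth_on U \<alpha> \<and> (\<forall>p\<in>U. homog k (\<alpha> p))}"

text \<open>For \<open>\<alpha> = \<Sum>\<^sub>I \<alpha>\<^sub>I dw\<^sub>I\<close> we have \<open>d\<alpha> = \<Sum>\<^sub>i dw\<^sub>i \<and> W\<^sub>i\<alpha> + \<Sum>\<^sub>I \<alpha>\<^sub>I d(dw\<^sub>I)\<close>, where \<open>W\<^sub>i\<close> acts on the
  coefficients. Since \<open>d(dw\<^sub>i) = 0\<close> for \<open>i \<le> 2n\<close>, the Leibniz rule gives \<open>d(dw\<^sub>I) = 0\<close> if \<open>\<theta>\<close> does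
  not occur in \<open>dw\<^sub>I\<close>, and \<open>d(\<theta> \<and> dw\<^sub>I) = d\<theta> \<and> dw\<^sub>I\<close>.\<close>

definition ext_d :: "'n::finite form \<Rightarrow> 'n form" where
  "ext_d \<alpha> p = (\<Sum>i\<in>UNIV. dw i \<and>\<^sub>w Wderiv i \<alpha> p) + dtheta \<and>\<^sub>w contract_T (\<alpha> p)"


section \<open>Rumin forms\<close>

definition ideal_forms :: "int \<Rightarrow> 'n::finite heis set \<Rightarrow> 'n form set" where
  "ideal_forms k U = {\<gamma>. \<exists>\<alpha>\<in>forms (k - 1) U. \<exists>\<beta>\<in>forms (k - 2) U.
      \<forall>p\<in>U. \<gamma> p = \<alpha> p \<and>\<^sub>w theta + \<beta> p \<and>\<^sub>w dtheta}"

definition J_forms :: "int \<Rightarrow> 'n::finite heis set \<Rightarrow> 'n form set" where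
  "J_forms k U = {\<alpha>\<in>forms k U. \<forall>p\<in>U. \<alpha> p \<and>\<^sub>w theta = 0 \<and> \<alpha> p \<and>\<^sub>w dtheta = 0}"

text \<open>Rumin forms of both kinds are treated as cosets: of \<open>I\<^sup>k\<close> in \<open>\<Omega>\<^sup>k\<close> if \<open>k \<le> n\<close>, of \<open>0\<close> in \<open>J\<^sup>k\<close> if
  \<open>k \<ge> n + 1\<close>. In both cases two forms that agree on \<open>U\<close> are identified.\<close>

definition rumin_reps :: "nat \<Rightarrow> 'n::finite heis set \<Rightarrow> 'n form set" where
  "rumin_reps k U = (if k \<le> CARD('n) then forms (int k) U else J_forms (int k) U)"

definition rumin_null :: "nat \<Rightarrow> 'n::finite heis set \<Rightarrow> 'n form set" where
  "rumin_null k U = (if k \<le> CARD('n) then ideal_forms (int k) U else {\<gamma>. \<forall>p\<in>U. \<gamma> p = 0})"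

definition rumin_class :: "nat \<Rightarrow> 'n::finite heis set \<Rightarrow> 'n form \<Rightarrow> 'n form set" where
  "rumin_class k U \<alpha> = {\<beta>\<in>rumin_reps k U. (\<lambda>p. \<beta> p - \<alpha> p) \<in> rumin_null k U}"

definition rep :: "'n::finite form set \<Rightarrow> 'n form" where
  "rep \<omega> = (SOME \<alpha>. \<alpha> \<in> \<omega>)"

text \<open>The fibre of \<open>I\<^sup>k\<close> (respectively \<open>0\<close>) at a point; it has constant coefficients in the coframe.\<close>

definition null_fibre :: "nat \<Rightarrow> 'n::finite mvec set" where
  "null_fibre k = (if k \<le> CARD('n)
     then {c. \<exists>a b. homog (int k - 1) a \<and> homog (int k - 2) b \<and> c = a \<and>\<^sub>w theta + b \<and>\<^sub>w dtheta}
     else {0})"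

text \<open>Independent of the representative: \<open>rep \<omega> p \<notin> null_fibre k\<close> says that the section of the
  quotient bundle does not vanish at \<open>p\<close>.\<close>

definition form_spt :: "nat \<Rightarrow> 'n::finite heis set \<Rightarrow> 'n form set \<Rightarrow> 'n heis set" where
  "form_spt k U \<omega> = U \<inter> closure {p\<in>U. rep \<omega> p \<notin> null_fibre k}"

definition test_forms :: "nat \<Rightarrow> 'n::finite heis set \<Rightarrow> 'n form set set" where
  "test_forms k U =
     {\<omega>. (\<exists>\<alpha>\<in>rumin_reps k U. \<omega> = rumin_class k U \<alpha>) \<and> compact (form_spt k U \<omega>)}"

text \<open>\<open>\<L>(\<alpha>) = L\<^sup>-\<^sup>1(-(d\<alpha>)\<^bsub>|\<And>\<^sup>n\<^sup>+\<^sup>1 \<hh>\<^sub>1\<^esub>)\<close>, with \<open>L \<beta> = d\<theta> \<and> \<beta>\<close> on horizontal \<open>(n-1)\<close>-covectors.\<close>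

definition rumin_L :: "'n::finite form \<Rightarrow> 'n form" where
  "rumin_L \<alpha> p =
     inv_into {\<beta>. homog (int CARD('n) - 1) \<beta> \<and> horizontal_cov \<beta>} (\<lambda>\<beta>. dtheta \<and>\<^sub>w \<beta>)
       (- horizontal_part (ext_d \<alpha> p))"

text \<open>In degree \<open>n\<close> the correction term is written \<open>\<theta> \<and> \<L>(\<alpha>) = (-1)\<^sup>n\<^sup>-\<^sup>1 \<L>(\<alpha>) \<and> \<theta>\<close>. The horizontal
  part of \<open>d(\<alpha> + \<theta> \<and> \<L>(\<alpha>))\<close> is \<open>(d\<alpha>)\<^bsub>|\<And>\<^sup>n\<^sup>+\<^sup>1 \<hh>\<^sub>1\<^esub> + d\<theta> \<and> \<L>(\<alpha>) = 0\<close>, which is what makes the form lie in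
  \<open>J\<^sup>n\<^sup>+\<^sup>1\<close> and depend on the class of \<open>\<alpha>\<close> only. For the frequently printed \<open>\<L>(\<alpha>) \<and> \<theta>\<close> this holds
  for odd \<open>n\<close> only, where the two expressions coincide; for even \<open>n\<close> the sign is necessary.\<close>

definition rumin_d :: "nat \<Rightarrow> 'n::finite heis set \<Rightarrow> 'n form set \<Rightarrow> 'n form set" where
  "rumin_d k U \<omega> = rumin_class (Suc k) U
     (if k = CARD('n) then ext_d (\<lambda>p. rep \<omega> p + theta \<and>\<^sub>w rumin_L (rep \<omega>) p)
      else ext_d (rep \<omega>))"


section \<open>Currents\<close>

type_synonym 'n current = "'n form set \<Rightarrow> real"

text \<open>Continuity is continuity for the usual (inductive limit) topology of test forms, respectively
  its quotient: on the test forms with support in a fixed compact set, the functional is bounded by a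
  \<open>C\<^sup>N\<close> seminorm of every representative.\<close>

definition currents :: "nat \<Rightarrow> 'n::finite heis set \<Rightarrow> 'n current set" where
  "currents k U = {T.
     (\<forall>\<alpha>\<in>rumin_reps k U. \<forall>\<beta>\<in>rumin_reps k U. \<forall>a b.
        rumin_class k U \<alpha> \<in> test_forms k U \<longrightarrow> rumin_class k U \<beta> \<in> test_forms k U \<longrightarrow>
        T (rumin_class k U (\<lambda>p. a *\<^sub>R \<alpha> p + b *\<^sub>R \<beta> p))
          = a * T (rumin_class k U \<alpha>) + b * T (rumin_class k U \<beta>)) \<and>
     (\<forall>K. compact K \<and> K \<subseteq> U \<longrightarrow>
        (\<exists>C N. \<forall>\<alpha>\<in>rumin_reps k U. \<forall>B\<ge>0.
           form_spt k U (rumin_class k U \<alpha>) \<subseteq> K \<longrightarrow>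
           (\<forall>vs. set vs \<subseteq> Basis \<and> length vs \<le> N \<longrightarrow> (\<forall>p\<in>K. norm (iter_deriv vs \<alpha> p) \<le> B)) \<longrightarrow>
           \<bar>T (rumin_class k U \<alpha>)\<bar> \<le> C * B))}"

definition boundary :: "nat \<Rightarrow> 'n::finite heis set \<Rightarrow> 'n current \<Rightarrow> 'n current" where
  "boundary k U T = (if k = 0 then (\<lambda>\<omega>. 0) else (\<lambda>\<omega>. T (rumin_d (k - 1) U \<omega>)))"

definition current_spt :: "nat \<Rightarrow> 'n::finite heis set \<Rightarrow> 'n current \<Rightarrow> 'n heis set" where
  "current_spt k U T = U - \<Union>{V. open V \<and> V \<subseteq> U \<and>
      (\<forall>\<omega>\<in>test_forms k U. form_spt k U \<omega> \<subseteq> V \<longrightarrow> T \<omega> = 0)}"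

definition compact_currents :: "nat \<Rightarrow> 'n::finite heis set \<Rightarrow> 'n current set" where
  "compact_currents k U = {T\<in>currents k U. compact (current_spt k U T)}"


section \<open>Comass and mass\<close>

text \<open>Integrability of the distribution spanned by left invariant fields: through every point there
  passes an integral manifold, given by an immersion of an open subset of \<open>\<real>\<^sup>d\<close>, where \<open>d\<close> is the
  rank. Here and below \<open>\<real>\<^sup>d\<close>, \<open>d \<le> n\<close>, is a \<open>d\<close>-dimensional linear subspace of the type
  \<open>real ^ 'n\<close>.\<close>

definition integrable_fields :: "'n::finite heis list \<Rightarrow> bool" where
  "integrable_fields ws \<longleftrightarrow> (\<forall>p. \<exists>(E :: (real ^ 'n) set) Q \<phi> u0.
     subspace E \<and> dim E = dim (span (set ws)) \<and> open Q \<and> smooth_on Q \<phi> \<and>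
     u0 \<in> E \<inter> Q \<and> \<phi> u0 = p \<and>
     (\<forall>u\<in>E \<inter> Q. frechet_derivative \<phi> (at u) ` E = (\<lambda>w. left_field w (\<phi> u)) ` span (set ws)))"

text \<open>The scalar is redundant for \<open>m \<ge> 1\<close>; for \<open>m = 0\<close> it makes all of \<open>\<And>\<^sub>0 = \<real>\<close> simple.\<close>

definition horizontal_simple_integrable :: "nat \<Rightarrow> 'n::finite mvec set" where
  "horizontal_simple_integrable m =
     {c *\<^sub>R wedge_list ws |c ws. length ws = m \<and> set ws \<subseteq> horizontal_layer \<and> integrable_fields ws}"

definition simple_integrable :: "nat \<Rightarrow> 'n::finite mvec set" where
  "simple_integrable k = (if k \<le> CARD('n) then horizontal_simple_integrable k
     else hodge ` horizontal_simple_integrable (2 * CARD('n) + 1 - k))"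

definition HLambda :: "nat \<Rightarrow> 'n::finite mvec set" where
  "HLambda k = span (simple_integrable k)"

text \<open>\<open>\<langle>\<omega>(p)|v\<rangle>\<close> for \<open>v \<in> HLambda k\<close>, where it does not depend on the representative.\<close>

definition pairing :: "'n::finite form set \<Rightarrow> 'n heis \<Rightarrow> 'n mvec \<Rightarrow> real" where
  "pairing \<omega> p v = rep \<omega> p \<bullet> v"

definition comass :: "nat \<Rightarrow> 'n::finite form set \<Rightarrow> 'n heis \<Rightarrow> ereal" where
  "comass k \<omega> p = (SUP v\<in>{v\<in>simple_integrable k. norm v = 1}. ereal (pairing \<omega> p v))"

definition mass :: "nat \<Rightarrow> 'n::finite heis set \<Rightarrow> 'n current \<Rightarrow> ereal" where
  "mass k U T = (SUP \<omega>\<in>{\<omega>\<in>test_forms k U. \<forall>p\<in>U. comass k \<omega> p \<le> 1}. ereal (T \<omega>))"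

definition finite_mass_currents :: "nat \<Rightarrow> 'n::finite heis set \<Rightarrow> 'n current set" where
  "finite_mass_currents k U = {T\<in>compact_currents k U. mass k U T < \<infinity>}"

definition normal_currents :: "nat \<Rightarrow> 'n::finite heis set \<Rightarrow> 'n current set" where
  "normal_currents k U =
     {T\<in>compact_currents k U. mass k U T + mass (k - 1) U (boundary k U T) < \<infinity>}"


section \<open>Maps of class \<open>C\<^sup>1\<^sub>\<bbbH>\<close>\<close>

record 'a carnot =
  cset :: "'a set"
  cmult :: "'a \<Rightarrow> 'a \<Rightarrow> 'a"
  cinv :: "'a \<Rightarrow> 'a"
  cdil :: "real \<Rightarrow> 'a \<Rightarrow> 'a"
  cnorm :: "'a \<Rightarrow> real"

definition heis_group :: "'n::finite heis carnot" where
  "heis_group = \<lparr>cset = UNIV, cmult = hmult, cinv = uminus, cdil = hdil, cnorm = hnorm\<rparr>"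

definition euclid_group :: "'a::euclidean_space set \<Rightarrow> 'a carnot" where
  "euclid_group E = \<lparr>cset = E, cmult = (+), cinv = uminus, cdil = (*\<^sub>R), cnorm = norm\<rparr>"

definition homogeneous_hom :: "'a carnot \<Rightarrow> 'b carnot \<Rightarrow> ('a \<Rightarrow> 'b) \<Rightarrow> bool" where
  "homogeneous_hom G H L \<longleftrightarrow>
     (\<forall>x\<in>cset G. L x \<in> cset H) \<and>
     (\<forall>x\<in>cset G. \<forall>y\<in>cset G. L (cmult G x y) = cmult H (L x) (L y)) \<and>
     (\<forall>r>0. \<forall>x\<in>cset G. L (cdil G r x) = cdil H r (L x))"

definition pansu_derivative ::
    "'a::topological_space carnot \<Rightarrow> 'b carnot \<Rightarrow> 'a set \<Rightarrow> ('a \<Rightarrow> 'b) \<Rightarrow> 'a \<Rightarrow> ('a \<Rightarrow> 'b) \<Rightarrow> bool" where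
  "pansu_derivative G H A f p L \<longleftrightarrow> homogeneous_hom G H L \<and>
     ((\<lambda>q. cnorm H (cmult H (cinv H (L (cmult G (cinv G p) q))) (cmult H (cinv H (f p)) (f q)))
            / cnorm G (cmult G (cinv G p) q)) \<longlongrightarrow> 0) (at p within A)"

text \<open>Used for sets \<open>A\<close> that are relatively open in \<open>cset G\<close>, so that the Pansu differential \<open>D p\<close> is
  unique on \<open>cset G\<close>. Maps into \<open>\<real>\<^sup>m\<close> are treated componentwise.\<close>

definition C1H_with ::
    "'a::topological_space carnot \<Rightarrow> 'b::topological_space carnot \<Rightarrow> 'a set \<Rightarrow> ('a \<Rightarrow> 'b)
      \<Rightarrow> ('a \<Rightarrow> 'a \<Rightarrow> 'b) \<Rightarrow> bool" where
  "C1H_with G H A f D \<longleftrightarrow> continuous_on A f \<and> f ` A \<subseteq> cset H \<and>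
     (\<forall>p\<in>A. pansu_derivative G H A f p (D p)) \<and>
     (\<forall>v\<in>cset G. continuous_on A (\<lambda>p. D p v))"


section \<open>Rectifiable sets\<close>

definition param_chart :: "nat \<Rightarrow> 'n::finite heis set \<Rightarrow> 'n heis \<Rightarrow> (real ^ 'n) set \<Rightarrow> (real ^ 'n) set
    \<Rightarrow> (real ^ 'n \<Rightarrow> 'n heis) \<Rightarrow> (real ^ 'n \<Rightarrow> real ^ 'n \<Rightarrow> 'n heis) \<Rightarrow> bool" where
  "param_chart k S p E A \<phi> D \<longleftrightarrow> subspace E \<and> dim E = k \<and> openin (top_of_set E) A \<and>
     (\<exists>V. open V \<and> p \<in> V \<and> \<phi> ` A \<subseteq> V \<and> S \<inter> V = \<phi> ` A) \<and>
     C1H_with (euclid_group E) heis_group A \<phi> D \<and> inj_on \<phi> A \<and> (\<forall>u\<in>A. inj_on (D u) E)"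

definition level_chart :: "nat \<Rightarrow> 'n::finite heis set \<Rightarrow> 'n heis \<Rightarrow> (nat \<Rightarrow> 'n heis \<Rightarrow> real) \<Rightarrow> bool" where
  "level_chart m S p f \<longleftrightarrow> (\<exists>V. open V \<and> p \<in> V \<and>
     (\<forall>i<m. \<exists>D. C1H_with heis_group (euclid_group UNIV) V (f i) D) \<and>
     (\<forall>q\<in>V. wedge_list (map (\<lambda>i. hgrad (f i) q) [0..<m]) \<noteq> 0) \<and>
     S \<inter> V = {q\<in>V. \<forall>i<m. f i q = 0})"

text \<open>\<open>\<bbbH>\<close>-regular surfaces of dimension \<open>k\<close>, which for \<open>k \<ge> n + 1\<close> means
  codimension \<open>2n + 1 - k\<close>.\<close>

definition H_regular_surface :: "nat \<Rightarrow> 'n::finite heis set \<Rightarrow> bool" where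
  "H_regular_surface k S \<longleftrightarrow> (\<forall>p\<in>S.
     if k \<le> CARD('n) then \<exists>E A \<phi> D. param_chart k S p E A \<phi> D
     else \<exists>f. level_chart (2 * CARD('n) + 1 - k) S p f)"

text \<open>The tangent space of a regular surface at a point, as a subspace of \<open>\<hh>\<close>: the image of
  \<open>d\<^sub>H\<phi>\<close>, respectively the kernel of \<open>d\<^sub>Hf\<close> (which contains the vertical direction).\<close>

definition tangent_space :: "nat \<Rightarrow> 'n::finite heis set \<Rightarrow> 'n heis \<Rightarrow> 'n heis set \<Rightarrow> bool" where
  "tangent_space k S p P \<longleftrightarrow>
     (if k \<le> CARD('n)
      then \<exists>E A \<phi> D u. param_chart k S p E A \<phi> D \<and> u \<in> A \<and> \<phi> u = p \<and> P = D u ` E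
      else \<exists>f. level_chart (2 * CARD('n) + 1 - k) S p f \<and>
             P = {w. \<forall>i < 2 * CARD('n) + 1 - k. hgrad (f i) p \<bullet> w = 0})"

definition unit_tangent :: "nat \<Rightarrow> 'n::finite heis set \<Rightarrow> 'n heis \<Rightarrow> 'n mvec \<Rightarrow> bool" where
  "unit_tangent k S p v \<longleftrightarrow> norm v = 1 \<and>
     (\<exists>P ws. tangent_space k S p P \<and> length ws = k \<and> set ws \<subseteq> P \<and> v = wedge_list ws)"

definition surface_orientation :: "nat \<Rightarrow> 'n::finite heis set \<Rightarrow> ('n heis \<Rightarrow> 'n mvec) \<Rightarrow> bool" where
  "surface_orientation k S t \<longleftrightarrow> continuous_on S t \<and> (\<forall>p\<in>S. unit_tangent k S p (t p))"

text \<open>Spherical Hausdorff measure for \<open>d\<^sub>\<infinity>\<close> by Caratheodory's construction, with Federer's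
  normalisation \<open>\<alpha>(m) 2\<^sup>-\<^sup>m diam(B)\<^sup>m\<close>; a \<open>d\<^sub>\<infinity>\<close>-ball of radius \<open>r\<close> has diameter \<open>2r\<close>.\<close>

definition hball :: "'n::finite heis \<Rightarrow> real \<Rightarrow> 'n heis set" where
  "hball p r = {q. hdist p q \<le> r}"

definition spherical_premeasure :: "nat \<Rightarrow> real \<Rightarrow> 'n::finite heis set \<Rightarrow> ennreal" where
  "spherical_premeasure m \<delta> A =
     (INF (c, r) \<in> {(c :: nat \<Rightarrow> 'n heis, r :: nat \<Rightarrow> real).
                     (\<forall>i. 0 \<le> r i \<and> 2 * r i \<le> \<delta>) \<and> A \<subseteq> (\<Union>i. hball (c i) (r i))}.
        \<Sum>i. ennreal (unit_ball_vol (real m) * r i ^ m))"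

definition spherical_outer :: "nat \<Rightarrow> 'n::finite heis set \<Rightarrow> ennreal" where
  "spherical_outer m A = (SUP \<delta>\<in>{0<..}. spherical_premeasure m \<delta> A)"

definition spherical_measure :: "nat \<Rightarrow> 'n::finite heis measure" where
  "spherical_measure m =
     measure_of UNIV (lambda_system UNIV (Pow UNIV) (spherical_outer m)) (spherical_outer m)"

definition mu :: "nat \<Rightarrow> 'n::finite heis measure" where
  "mu k = (if k \<le> CARD('n) then spherical_measure k else spherical_measure (k + 1))"

definition H_rectifiable :: "nat \<Rightarrow> 'n::finite heis set \<Rightarrow> bool" where
  "H_rectifiable k S \<longleftrightarrow> S \<in> sets (mu k) \<and> emeasure (mu k) S < \<infinity> \<and>
     (\<exists>S0 (Sj :: nat \<Rightarrow> 'n heis set). S0 \<in> null_sets (mu k) \<and>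
        (\<forall>j. H_regular_surface k (Sj j)) \<and> S \<subseteq> S0 \<union> (\<Union>j. Sj j))"

text \<open>\<open>\<tau>\<close> orients \<open>S\<close>: up to a null set \<open>S\<close> is a disjoint union of Borel pieces of oriented regular
  surfaces, and on each piece \<open>\<tau>\<close> is the orienting unit tangent \<open>k\<close>-vector field.\<close>

definition orients :: "nat \<Rightarrow> 'n::finite heis set \<Rightarrow> ('n heis \<Rightarrow> 'n mvec) \<Rightarrow> bool" where
  "orients k S \<tau> \<longleftrightarrow> (\<exists>(Sj :: nat \<Rightarrow> 'n heis set) B t.
     (\<forall>j. H_regular_surface k (Sj j) \<and> surface_orientation k (Sj j) (t j) \<and>
          B j \<in> sets borel \<and> B j \<subseteq> Sj j \<and> (\<forall>p\<in>B j. \<tau> p = t j p)) \<and>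
     disjoint_family B \<and>
     (S - (\<Union>j. B j)) \<union> ((\<Union>j. B j) - S) \<in> null_sets (mu k))"


section \<open>Rectifiable currents\<close>

text \<open>Only the values of a current on test forms are meaningful. The multiplicity has values in
  the natural numbers and is positive on the carrier; the representing integrals are required to
  exist.\<close>

definition rectifiable_currents :: "nat \<Rightarrow> 'n::finite heis set \<Rightarrow> 'n current set" where
  "rectifiable_currents k U =
    (if k = 0
     then {T. \<exists>F (c :: 'n heis \<Rightarrow> int). finite F \<and> F \<subseteq> U \<and>
            (\<forall>\<omega>\<in>test_forms 0 U. T \<omega> = (\<Sum>p\<in>F. of_int (c p) * pairing \<omega> p ext_one))}
     else {T\<in>compact_currents k U. \<exists>S \<tau> (\<rho> :: 'n heis \<Rightarrow> nat).
            S \<subseteq> U \<and> H_rectifiable k S \<and> orients k S \<tau> \<and>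
            (AE p in mu k. p \<in> S \<longrightarrow> \<tau> p \<in> HLambda k) \<and>
            \<rho> \<in> measurable (restrict_space (mu k) S) (count_space UNIV) \<and> (\<forall>p\<in>S. 0 < \<rho> p) \<and>
            (\<forall>\<omega>\<in>test_forms k U. has_bochner_integral (mu k)
               (\<lambda>p. indicator S p * (pairing \<omega> p (\<tau> p) * real (\<rho> p))) (T \<omega>)) \<and>
            (\<integral>\<^sup>+ p \<in> S \<inter> current_spt k U T. ennreal (real (\<rho> p)) \<partial>mu k) < \<infinity>})"

definition integral_currents :: "nat \<Rightarrow> 'n::finite heis set \<Rightarrow> 'n current set" where
  "integral_currents k U =
     {T\<in>rectifiable_currents k U. boundary k U T \<in> rectifiable_currents (k - 1) U}"

end

theory Submission
  imports Defs
begin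

text \<open>The current is represented by \<open>\<tau> \<rho>\<close> on \<open>S\<close>, while \<open>\<rho>\<close> is only known to be summable on
  \<open>S \<inter> spt T\<close>. Off \<open>spt T\<close> the density \<open>\<langle>\<omega>|\<tau>\<rangle> \<rho>\<close> of a fixed test form \<open>\<omega>\<close> vanishes almost
  everywhere, since \<open>T\<close> annihilates the products of \<open>\<omega>\<close> with smooth functions supported there. On
  \<open>S \<inter> spt T\<close> the comass controls \<open>\<langle>\<omega>|\<tau>\<rangle>\<close> up to a constant, because \<open>\<tau>\<close> is a unit vector in a
  finite-dimensional space spanned by simple integrable vectors. Cutting off is only possible because
  the pairing does not depend on the representative, that is, because horizontal distributions that
  are integrable are isotropic for \<open>d\<theta>\<close>.\<close>

section \<open>Interior products and isotropic multivectors\<close>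

text \<open>A cut-off product f \<omega> is only a coset, and the representative that
  \<open>rep\<close> picks for it need not be f times the one picked for \<omega>. The two differ
  pointwise by a covector a \<and> \<theta> + b \<and> d\<theta>: horizontality of the tangent
  vectors disposes of the first summand, isotropy of the second. Above the middle degree this fibre
  is zero. Integrability is given through integral manifolds rather than brackets, so isotropy has
  to be extracted from an immersion. A second obstacle is that measurability of Borel sets, hence of
  spt T, for \<open>mu k\<close> is not established. The vanishing off spt T is therefore derived
  from boxes and smooth bumps, with Borel sets entering through integrals and hulls. The exceptional
  null set may depend on \<omega>, since the estimate treats one test form at a time. The resulting
  bound on the mass is C times the integral of \<rho> over S \<inter> spt T, with C depending only
  on k and n.\<close>

definition contr :: "'n::finite hidx \<Rightarrow> 'n mvec \<Rightarrow> 'n mvec" where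
  "contr i w = (\<chi> L. if i \<in> L then 0
     else (- 1) ^ card {l\<in>L. hpos l < hpos i} * w $ insert i L)"

lemma coord_no_bij: "bij_betw (coord_no :: 'n::finite \<Rightarrow> nat) UNIV {..<CARD('n)}"
proof -
  have "\<exists>f. bij_betw f (UNIV :: 'n set) {..<CARD('n)}"
    using ex_bij_betw_finite_nat[OF finite_class.finite_UNIV] by (simp add: atLeast0LessThan)
  then show ?thesis unfolding coord_no_def by (rule someI_ex)
qed

lemma coord_no_less: "coord_no (j :: 'n::finite) < CARD('n)"
  using coord_no_bij[where 'n='n] by (auto simp: bij_betw_def)

lemma hpos_eq_iff [simp]: "hpos i = hpos j \<longleftrightarrow> i = j"
proof -
  have inj: "coord_no a = coord_no b \<longleftrightarrow> a = b" for a b :: 'a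
    using coord_no_bij[where 'n='a] by (auto simp: bij_betw_def inj_on_def)
  show ?thesis
    using coord_no_less[where 'n='a] inj
    by (cases i; cases j) (simp_all, (metis add_lessD1 add_less_cancel_left coord_no_less
        less_irrefl mult_2 not_add_less1)+)
qed

lemma shuffle_sign_singleton: "shuffle_sign {m} J = (- 1) ^ card {l\<in>J. hpos l < hpos m}"
proof -
  have "{(i, j). i \<in> {m} \<and> j \<in> J \<and> hpos j < hpos i} = Pair m ` {l\<in>J. hpos l < hpos m}" by auto
  then show ?thesis unfolding shuffle_sign_def by (simp add: card_image inj_on_def)
qed

lemma vec1_nth: "vec1 u $ I = (\<Sum>i\<in>UNIV. if I = {i} then u $ i else 0)"
  unfolding vec1_def by (simp add: axis_def if_distrib cong: if_cong)

lemma vec1_singleton: "vec1 u $ {i} = u $ i"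
  unfolding vec1_nth by simp

lemma vec1_eq_0: "(\<And>i. I \<noteq> {i}) \<Longrightarrow> vec1 u $ I = 0"
  unfolding vec1_nth by simp

lemma vec1_wedge_nth:
  "(vec1 u \<and>\<^sub>w w) $ K = (\<Sum>m\<in>K. shuffle_sign {m} (K - {m}) * (u $ m * w $ (K - {m})))"
proof -
  have "(vec1 u \<and>\<^sub>w w) $ K = (\<Sum>I\<in>Pow K. shuffle_sign I (K - I) * (vec1 u $ I * w $ (K - I)))"
    by (simp add: wedge_def)
  also have "\<dots> = (\<Sum>I\<in>(\<lambda>m. {m}) ` K. shuffle_sign I (K - I) * (vec1 u $ I * w $ (K - I)))"
    by (rule sum.mono_neutral_right) (auto simp: vec1_eq_0 image_iff, metis insertI1 subsetD vec1_eq_0)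
  also have "\<dots> = (\<Sum>m\<in>K. shuffle_sign {m} (K - {m}) * (u $ m * w $ (K - {m})))"
    by (subst sum.reindex) (auto simp: vec1_singleton inj_on_def)
  finally show ?thesis .
qed

text \<open>\<open>contr i\<close> is the interior product with \<open>dw i\<close>, and this is its
  antiderivation rule. In coefficients, the terms with m = i carry a squared sign and produce
  \<open>u $ i *\<^sub>R w\<close>; all others change sign.\<close>

lemma contr_wedge: "contr i (vec1 u \<and>\<^sub>w w) = u $ i *\<^sub>R w - vec1 u \<and>\<^sub>w contr i w"
proof (rule vec_eq_iff[THEN iffD2], rule allI)
  fix L :: "'a hidx set"
  show "contr i (vec1 u \<and>\<^sub>w w) $ L = (u $ i *\<^sub>R w - vec1 u \<and>\<^sub>w contr i w) $ L"
  proof (cases "i \<in> L")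
    case True
    have "(vec1 u \<and>\<^sub>w contr i w) $ L
        = (\<Sum>m\<in>L. if m = i then u $ i * w $ L else 0)"
      unfolding vec1_wedge_nth
    proof (rule sum.cong[OF refl])
      fix m assume "m \<in> L"
      have "{l \<in> L - {i}. hpos l < hpos i} = {l \<in> L. hpos l < hpos i}" by auto
      with True \<open>m \<in> L\<close> show "shuffle_sign {m} (L - {m}) * (u $ m * contr i w $ (L - {m}))
          = (if m = i then u $ i * w $ L else 0)"
        by (auto simp: contr_def shuffle_sign_singleton insert_absorb power_add[symmetric]
              simp flip: mult_2 mult.assoc)
    qed
    with True show ?thesis by (simp add: contr_def)
  next
    case False
    let ?s = "\<lambda>K k. (- 1) ^ card {l\<in>K. hpos l < hpos k} :: real"
    have 1: "contr i (vec1 u \<and>\<^sub>w w) $ L = ?s L i * (\<Sum>m\<in>insert i L.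
        shuffle_sign {m} (insert i L - {m}) * (u $ m * w $ (insert i L - {m})))"
      using False by (simp add: contr_def vec1_wedge_nth)
    also have "\<dots> = ?s L i * (shuffle_sign {i} L * (u $ i * w $ L)) + (\<Sum>m\<in>L. ?s L i *
        (shuffle_sign {m} (insert i L - {m}) * (u $ m * w $ (insert i L - {m}))))"
      using False by (simp add: sum_distrib_left distrib_left)
    also have "?s L i * (shuffle_sign {i} L * (u $ i * w $ L)) = u $ i * w $ L"
      by (simp add: shuffle_sign_singleton power_add[symmetric] flip: mult_2 mult.assoc)
    also have "(\<Sum>m\<in>L. ?s L i * (shuffle_sign {m} (insert i L - {m}) *
          (u $ m * w $ (insert i L - {m}))))
        = (\<Sum>m\<in>L. - (shuffle_sign {m} (L - {m}) * (u $ m * contr i w $ (L - {m}))))"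
    proof (rule sum.cong[OF refl])
      fix m assume m: "m \<in> L"
      then have mi: "m \<noteq> i" and ins: "insert i L - {m} = insert i (L - {m})" using False by auto
      \<comment> \<open>Either m counts for i or i counts for m, according to their order, and never
        both; this single extra factor is the minus sign.\<close>
      have "?s L i * ?s (insert i (L - {m})) m = - (?s (L - {m}) m * ?s (L - {m}) i)"
      proof (cases "hpos m < hpos i")
        case True
        have "{l\<in>L. hpos l < hpos i} = insert m {l\<in>L - {m}. hpos l < hpos i}"
          and "{l\<in>insert i (L - {m}). hpos l < hpos m} = {l\<in>L - {m}. hpos l < hpos m}"
          using True m by auto
        then show ?thesis by simp
      next
        case False
        then have "hpos i < hpos m" using mi by (metis hpos_eq_iff linorder_less_linear)
        then have "{l\<in>L. hpos l < hpos i} = {l\<in>L - {m}. hpos l < hpos i}"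
          and "{l\<in>insert i (L - {m}). hpos l < hpos m} = insert i {l\<in>L - {m}. hpos l < hpos m}"
          using m by auto
        then show ?thesis using \<open>i \<notin> L\<close> by simp
      qed
      then have "?s L i * ?s (insert i (L - {m})) m * (u $ m * w $ (insert i L - {m}))
        = - (?s (L - {m}) m * ?s (L - {m}) i) * (u $ m * w $ (insert i L - {m}))" by simp
      then show "?s L i * (shuffle_sign {m} (insert i L - {m}) *
          (u $ m * w $ (insert i L - {m})))
        = - (shuffle_sign {m} (L - {m}) * (u $ m * contr i w $ (L - {m})))"
        using False ins by (simp add: contr_def shuffle_sign_singleton algebra_simps)
    qed
    finally show ?thesis by (simp add: vec1_wedge_nth sum_negf)
  qed
qed

lemma contr_add: "contr i (v + w) = contr i v + contr i w"
  and contr_diff: "contr i (v - w) = contr i v - contr i w"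
  and contr_scale: "contr i (c *\<^sub>R w) = c *\<^sub>R contr i w"
  by (simp_all add: contr_def vec_eq_iff algebra_simps)

lemma linear_contr: "linear (contr i)"
  by (intro linearI contr_add contr_scale)

lemma linear_wedge: "linear (\<lambda>w. v \<and>\<^sub>w w)" "linear (\<lambda>v. v \<and>\<^sub>w w)"
  by (auto intro!: linearI simp: wedge_def vec_eq_iff algebra_simps sum.distrib sum_distrib_left)

section \<open>The symplectic form and the operator dual to wedging with d\<theta>\<close>

definition symp :: "'n::finite heis \<Rightarrow> 'n heis \<Rightarrow> real" where
  "symp u v = (\<Sum>j\<in>UNIV. u $ Xc j * v $ Yc j - u $ Yc j * v $ Xc j)"

definition isotropic :: "'n::finite heis set \<Rightarrow> bool" where
  "isotropic S \<longleftrightarrow> (\<forall>u\<in>S. \<forall>v\<in>S. symp u v = 0)"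

text \<open>Interior product with the covector \<open>symp u\<close>. The form \<open>symp\<close>
  is -d\<theta>; on horizontal vectors it is the vertical component of the bracket of the left
  invariant fields.\<close>

definition Jcontr :: "'n::finite heis \<Rightarrow> 'n mvec \<Rightarrow> 'n mvec" where
  "Jcontr u w = (\<Sum>j\<in>UNIV. u $ Xc j *\<^sub>R contr (Yc j) w - u $ Yc j *\<^sub>R contr (Xc j) w)"

text \<open>The analogue of the dual Lefschetz operator: up to sign the transpose of right
  multiplication by d\<theta>, see \<open>wedge_dtheta_inner\<close>.\<close>

definition Lam :: "'n::finite mvec \<Rightarrow> 'n mvec" where
  "Lam w = (\<Sum>j\<in>UNIV. contr (Yc j) (contr (Xc j) w))"

lemma contr_ext_one [simp]: "contr i ext_one = 0"
  by (simp add: contr_def ext_one_def axis_def vec_eq_iff)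

lemma Jcontr_wedge: "Jcontr v (vec1 u \<and>\<^sub>w w) = symp v u *\<^sub>R w - vec1 u \<and>\<^sub>w Jcontr v w"
  by (simp add: Jcontr_def symp_def contr_wedge linear_sum[OF linear_wedge(1)]
      linear_diff[OF linear_wedge(1)] linear_scale[OF linear_wedge(1)] scaleR_sum_left
      algebra_simps sum.distrib sum_subtractf)

lemma Lam_wedge: "Lam (vec1 u \<and>\<^sub>w w) = Jcontr u w + vec1 u \<and>\<^sub>w Lam w"
  by (simp add: Jcontr_def Lam_def contr_wedge linear_sum[OF linear_wedge(1)] contr_diff contr_scale
      algebra_simps sum.distrib sum_subtractf)

lemma wedge_list_simps [simp]:
  "wedge_list [] = ext_one" "wedge_list (w # ws) = vec1 w \<and>\<^sub>w wedge_list ws"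
  by (simp_all add: wedge_list_def)

lemma Jcontr_wedge_list: "(\<And>u. u \<in> set ws \<Longrightarrow> symp v u = 0) \<Longrightarrow> Jcontr v (wedge_list ws) = 0"
  by (induction ws)
     (auto simp: Jcontr_wedge linear_0[OF linear_wedge(1)], simp add: Jcontr_def)

text \<open>Unfolded, \<open>Lam\<close> of a wedge product removes two factors at a time and
  multiplies by their \<open>symp\<close>; on an isotropic set all these coefficients
  vanish.\<close>

lemma Lam_wedge_list: "isotropic (set ws) \<Longrightarrow> Lam (wedge_list ws) = 0"
proof (induction ws)
  case Nil
  then show ?case by (simp add: Lam_def linear_0[OF linear_contr])
next
  case (Cons u ws)
  then have "isotropic (set ws)" and "\<And>v. v \<in> set ws \<Longrightarrow> symp u v = 0"
    by (auto simp: isotropic_def)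
  then show ?case using Cons.IH
    by (simp add: Lam_wedge Jcontr_wedge_list linear_0[OF linear_wedge(1)])
qed

lemma dtheta_eq: "dtheta = - (\<Sum>j\<in>UNIV. axis {Xc j, Yc j} 1 :: 'n::finite mvec)"
proof -
  have "dw (Xc j) \<and>\<^sub>w dw (Yc j) = (axis {Xc j, Yc j} 1 :: 'n mvec)" for j :: 'n
  proof (rule vec_eq_iff[THEN iffD2], rule allI)
    fix K :: "'n hidx set"
    have e: "dw i = vec1 (axis i 1)" for i :: "'n hidx"
      by (simp add: dw_def vec1_def axis_def[of i] if_distrib[of "\<lambda>x. x *\<^sub>R _"] cong: if_cong)
    have "(dw (Xc j) \<and>\<^sub>w dw (Yc j)) $ K
        = (\<Sum>m\<in>K. if m = Xc j then shuffle_sign {m} (K - {m}) * dw (Yc j) $ (K - {m}) else 0)"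
      unfolding e[of "Xc j"] vec1_wedge_nth
      by (rule sum.cong[OF refl]) (simp add: axis_def)
    also have "\<dots> = (if Xc j \<in> K then shuffle_sign {Xc j} (K - {Xc j}) * dw (Yc j) $ (K - {Xc j}) else 0)"
      by simp
    also have "\<dots> = axis {Xc j, Yc j} 1 $ K"
    proof -
      have "Xc j \<in> K \<and> {Yc j} = K - {Xc j} \<longleftrightarrow> {Xc j, Yc j} = K" by auto
      moreover have "shuffle_sign {Xc j} {Yc j} = 1"
      proof -
        \<comment> \<open>Every \<open>Xc\<close> precedes every \<open>Yc\<close> in the chosen
          order, which fixes the sign as +1.\<close>
        have "{l\<in>{Yc j}. hpos l < hpos (Xc j)} = {}" using coord_no_less[of j] by auto
        then show ?thesis by (simp only: shuffle_sign_singleton card.empty power_0)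
      qed
      ultimately show ?thesis by (auto simp: dw_def axis_def)
    qed
    finally show "(dw (Xc j) \<and>\<^sub>w dw (Yc j)) $ K = axis {Xc j, Yc j} 1 $ K" .
  qed
  then show ?thesis by (simp add: dtheta_def)
qed

text \<open>\<open>shuffle_sign\<close> counts the members of L above x and y, \<open>contr\<close>
  those below. For each point the two counts add up to \<open>card L\<close>, and twice
  \<open>card L\<close> is even.\<close>

lemma shuffle_sign_pair:
  fixes L :: "'n::finite hidx set"
  assumes "x \<notin> L" "y \<notin> L" "x \<noteq> y"
  shows "shuffle_sign L {x, y}
    = (- 1) ^ card {l\<in>L. hpos l < hpos x} * (- 1) ^ card {l\<in>L. hpos l < hpos y}"
proof -
  have "{(i, j). i \<in> L \<and> j \<in> {x, y} \<and> hpos j < hpos i}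
      = (\<lambda>l. (l, x)) ` {l\<in>L. hpos x < hpos l} \<union> (\<lambda>l. (l, y)) ` {l\<in>L. hpos y < hpos l}" by auto
  moreover have "card \<dots> = card {l\<in>L. hpos x < hpos l} + card {l\<in>L. hpos y < hpos l}"
    using assms(3) by (subst card_Un_disjoint) (auto simp: card_image inj_on_def)
  moreover have split: "card {l\<in>L. hpos z < hpos l} + card {l\<in>L. hpos l < hpos z} = card L"
    if "z \<notin> L" for z
  proof -
    have "hpos l \<noteq> hpos z" if "l \<in> L" for l using \<open>z \<notin> L\<close> that by auto
    then have "L = {l\<in>L. hpos z < hpos l} \<union> {l\<in>L. hpos l < hpos z}"
      by (auto simp del: hpos_eq_iff simp: nat_neq_iff)
    then have "card L = card ({l\<in>L. hpos z < hpos l} \<union> {l\<in>L. hpos l < hpos z})" by simp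
    also have "\<dots> = card {l\<in>L. hpos z < hpos l} + card {l\<in>L. hpos l < hpos z}"
      by (rule card_Un_disjoint) auto
    finally show ?thesis by simp
  qed
  ultimately have e: "shuffle_sign L {x, y}
      = (- 1) ^ (card {l\<in>L. hpos x < hpos l} + card {l\<in>L. hpos y < hpos l})"
    by (simp add: shuffle_sign_def)
  have "even (card {l\<in>L. hpos x < hpos l} + card {l\<in>L. hpos y < hpos l})
      \<longleftrightarrow> even (card {l\<in>L. hpos l < hpos x} + card {l\<in>L. hpos l < hpos y})"
    using split[OF assms(1)] split[OF assms(2)] by presburger
  then show ?thesis unfolding e power_add[symmetric] by (simp add: minus_one_power_iff)
qed

text \<open>Right multiplication by dx_j \<and> dy_j adds \<open>Xc j\<close> and
  \<open>Yc j\<close> to an index set, the double contraction removes them, and the signs agree; the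
  minus sign is that of d\<theta>.\<close>

lemma wedge_dtheta_inner: "(b \<and>\<^sub>w dtheta) \<bullet> w = - (b \<bullet> Lam w)"
proof -
  have "(b \<and>\<^sub>w axis {Xc j, Yc j} 1) \<bullet> w = b \<bullet> contr (Yc j) (contr (Xc j) w)" for j
  proof -
    let ?P = "{Xc j, Yc j}"
    have nth: "(b \<and>\<^sub>w axis ?P 1) $ K = (if ?P \<subseteq> K then shuffle_sign (K - ?P) ?P * b $ (K - ?P) else 0)"
      for K
    proof -
      have "(b \<and>\<^sub>w axis ?P 1) $ K
          = (\<Sum>I\<in>Pow K. if I = K - ?P \<and> ?P \<subseteq> K then shuffle_sign (K - ?P) ?P * b $ (K - ?P) else 0)"
        unfolding wedge_def vec_lambda_beta
      proof (rule sum.cong[OF refl])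
        fix I assume "I \<in> Pow K"
        then have "?P = K - I \<longleftrightarrow> I = K - ?P \<and> ?P \<subseteq> K" by auto
        moreover have "K - (K - ?P) = ?P" if "?P \<subseteq> K" using that by auto
        ultimately show "shuffle_sign I (K - I) * (b $ I * axis ?P 1 $ (K - I)) =
          (if I = K - ?P \<and> ?P \<subseteq> K then shuffle_sign (K - ?P) ?P * b $ (K - ?P) else 0)"
          by (auto simp: axis_def)
      qed
      also have "\<dots> = (if ?P \<subseteq> K then shuffle_sign (K - ?P) ?P * b $ (K - ?P) else 0)"
        by (cases "?P \<subseteq> K") auto
      finally show ?thesis .
    qed
    have "(b \<and>\<^sub>w axis ?P 1) \<bullet> w = (\<Sum>K | ?P \<subseteq> K. shuffle_sign (K - ?P) ?P * b $ (K - ?P) * w $ K)"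
      unfolding inner_vec_def nth by (simp add: if_distrib[of "\<lambda>x. x * _"] sum.If_cases)
    also have "\<dots> = (\<Sum>L | ?P \<inter> L = {}. shuffle_sign L ?P * b $ L * w $ (?P \<union> L))"
      by (rule sum.reindex_bij_witness[of _ "\<lambda>L. ?P \<union> L" "\<lambda>K. K - ?P"])
         (auto simp: Un_Diff_cancel intro!: arg_cong2[where f="(*)"] arg_cong[where f="vec_nth w"])
    also have "\<dots> = (\<Sum>L\<in>UNIV. b $ L * contr (Yc j) (contr (Xc j) w) $ L)"
    proof (rule sum.mono_neutral_cong_left)
      show "\<forall>L\<in>UNIV - {L. ?P \<inter> L = {}}. b $ L * contr (Yc j) (contr (Xc j) w) $ L = 0"
        by (auto simp: contr_def)
      fix L assume "L \<in> {L. ?P \<inter> L = {}}"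
      then have n: "Xc j \<notin> L" "Yc j \<notin> L" by auto
      \<comment> \<open>\<open>Yc j\<close> comes after \<open>Xc j\<close>, so its presence leaves
        the sign of contracting \<open>Xc j\<close> unchanged.\<close>
      have "{l \<in> insert (Yc j) L. hpos l < hpos (Xc j)} = {l \<in> L. hpos l < hpos (Xc j)}"
        using coord_no_less[of j] by auto
      then show "shuffle_sign L ?P * b $ L * w $ (?P \<union> L)
          = b $ L * contr (Yc j) (contr (Xc j) w) $ L"
        using n by (simp add: contr_def shuffle_sign_pair)
    qed auto
    finally show ?thesis by (simp add: inner_vec_def)
  qed
  then show ?thesis
    by (simp add: dtheta_eq Lam_def linear_neg[OF linear_wedge(1)] linear_sum[OF linear_wedge(1)]
        inner_sum_left inner_sum_right)
qed

lemma wedge_theta_nth: "Tc \<notin> K \<Longrightarrow> (a \<and>\<^sub>w theta) $ K = 0"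
  by (auto simp: wedge_def theta_def dw_def axis_def intro!: sum.neutral)

lemma wedge_list_horizontal:
  "set ws \<subseteq> horizontal_layer \<Longrightarrow> Tc \<in> K \<Longrightarrow> wedge_list ws $ K = 0"
proof (induction ws arbitrary: K)
  case Nil
  then show ?case by (auto simp: ext_one_def axis_def)
next
  case (Cons u ws)
  show ?case unfolding wedge_list_simps vec1_wedge_nth
  proof (rule sum.neutral, rule ballI)
    fix m assume "m \<in> K"
    show "shuffle_sign {m} (K - {m}) * (u $ m * wedge_list ws $ (K - {m})) = 0"
      using Cons by (cases "m = Tc") (auto simp: horizontal_layer_def)
  qed
qed

lemma wedge_theta_inner: "set ws \<subseteq> horizontal_layer \<Longrightarrow> (a \<and>\<^sub>w theta) \<bullet> wedge_list ws = 0"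
  unfolding inner_vec_def
  by (rule sum.neutral) (metis inner_zero_left inner_zero_right wedge_list_horizontal wedge_theta_nth)


section \<open>Integrable distributions are isotropic\<close>

lemma left_field_nth [simp]:
  "left_field w p $ Xc j = w $ Xc j"
  "left_field w p $ Yc j = w $ Yc j"
  "left_field w p $ Tc = w $ Tc + symp p w / 2"
proof -
  have S: "(\<Sum>i\<in>UNIV. F i) = F Tc + (\<Sum>j\<in>UNIV. F (Xc j)) + (\<Sum>j\<in>UNIV. F (Yc j))"
    for F :: "'a hidx \<Rightarrow> real"
    unfolding UNIV_hidx
    by (subst sum.insert, auto simp: sum.union_disjoint sum.reindex inj_on_def image_iff add.assoc)
       (subst sum.union_disjoint, auto simp: sum.reindex inj_on_def)
  show "left_field w p $ Xc j = w $ Xc j" "left_field w p $ Yc j = w $ Yc j"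
    by (simp_all add: left_field_def S axis_def if_distrib if_distribR cong: if_cong)
  show "left_field w p $ Tc = w $ Tc + symp p w / 2"
    by (simp add: left_field_def S axis_def symp_def sum_subtractf sum_negf diff_divide_distrib
        sum_divide_distrib algebra_simps)
qed

lemma symp_linear: "linear (\<lambda>u. symp u v)" "linear (symp u)"
  by (auto intro!: linearI simp: symp_def algebra_simps sum.distrib sum_subtractf sum_distrib_left)

lemma symp_self: "symp u u = 0"
  by (simp add: symp_def mult.commute)

lemma symp_left_field [simp]: "symp (left_field v p) (left_field w q) = symp v w"
  "symp p (left_field w q) = symp p w"
  by (simp_all add: symp_def)

lemma tendsto_symp [tendsto_intros]:
  "(f \<longlongrightarrow> a) F \<Longrightarrow> (g \<longlongrightarrow> b) F \<Longrightarrow> ((\<lambda>x. symp (f x) (g x)) \<longlongrightarrow> symp a b) F"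
  unfolding symp_def by (intro tendsto_intros)

text \<open>\<open>smooth_on\<close> speaks of directions in \<open>Basis\<close> only; linearity of
  the derivative extends continuity to any fixed v.\<close>

lemma isCont_frechet_derivative:
  assumes "open Q" "smooth_on Q \<phi>" "u \<in> Q"
  shows "isCont (\<lambda>x. frechet_derivative \<phi> (at x) v) u"
proof -
  have d: "\<phi> differentiable (at x)" if "x \<in> Q" for x
    using assms(2) that unfolding smooth_on_def
    by (metis empty_set empty_subsetI iter_deriv.simps(1))
  have "isCont (\<lambda>x. frechet_derivative \<phi> (at x) i) u" if "i \<in> Basis" for i
  proof -
    have "iter_deriv [i] \<phi> differentiable (at u)"
      using assms(2,3) that unfolding smooth_on_def
      by (metis empty_set empty_subsetI insert_subset list.simps(15))
    then show ?thesis by (simp add: differentiable_imp_continuous_within)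
  qed
  then have "isCont (\<lambda>x. \<Sum>i\<in>Basis. (v \<bullet> i) *\<^sub>R frechet_derivative \<phi> (at x) i) u"
    by (intro continuous_intros)
  moreover have "eventually (\<lambda>x. (\<Sum>i\<in>Basis. (v \<bullet> i) *\<^sub>R frechet_derivative \<phi> (at x) i)
      = frechet_derivative \<phi> (at x) v) (nhds u)"
  proof (rule eventually_nhds[THEN iffD2], intro exI[of _ Q] conjI ballI assms)
    fix x assume "x \<in> Q"
    then have l: "linear (frechet_derivative \<phi> (at x))" by (intro linear_frechet_derivative d)
    have "frechet_derivative \<phi> (at x) v = frechet_derivative \<phi> (at x) (\<Sum>i\<in>Basis. (v \<bullet> i) *\<^sub>R i)"
      by (simp add: euclidean_representation)
    then show "(\<Sum>i\<in>Basis. (v \<bullet> i) *\<^sub>R frechet_derivative \<phi> (at x) i)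
      = frechet_derivative \<phi> (at x) v"
      by (simp add: linear_sum[OF l] linear_scale[OF l])
  qed
  ultimately show ?thesis by (subst (asm) isCont_cong) auto
qed

text \<open>A surface tangent to the horizontal distribution satisfies
  \<open>d\<phi>\<^sub>\<tau> = \<omega>(\<phi>, d\<phi>)/2\<close>, so the \<open>\<tau>\<close>-coordinate along two sides of a triangle with one vertex at the
  origin is determined to second order. Going around the triangle gives isotropy without second
  derivatives of \<open>\<phi>\<close>.\<close>

lemma horizontal_second_difference:
  fixes \<phi> :: "real ^ 'n \<Rightarrow> 'n::finite heis"
  assumes Q: "open Q" "smooth_on Q \<phi>" and E: "subspace E" "u0 \<in> E \<inter> Q" and 0: "\<phi> u0 = 0"
    and hor: "\<And>u e. u \<in> E \<inter> Q \<Longrightarrow> e \<in> E \<Longrightarrow>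
      frechet_derivative \<phi> (at u) e $ Tc = symp (\<phi> u) (frechet_derivative \<phi> (at u) e) / 2"
    and ab: "a \<in> E" "b \<in> E"
  defines "A \<equiv> frechet_derivative \<phi> (at u0)"
  shows "((\<lambda>t. (\<phi> (u0 + t *\<^sub>R a + t *\<^sub>R b) $ Tc - \<phi> (u0 + t *\<^sub>R a) $ Tc) / t\<^sup>2)
    \<longlongrightarrow> symp (A a) (A b) / 2) (at_right 0)"
proof -
  let ?D = "\<lambda>u. frechet_derivative \<phi> (at u)"
  let ?u = "\<lambda>t s. u0 + t *\<^sub>R a + s *\<^sub>R b"
  have d: "(\<phi> has_derivative ?D x) (at x)" if "x \<in> Q" for x
  proof -
    have "\<phi> differentiable (at x)"
      using Q(2) that unfolding smooth_on_def
      by (metis empty_set empty_subsetI iter_deriv.simps(1))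
    then show ?thesis by (simp add: frechet_derivative_works)
  qed
  have u0: "u0 \<in> Q" using E by auto
  have linA: "linear A" unfolding A_def using d[OF u0] by (rule has_derivative_linear)
  obtain \<delta> where \<delta>: "\<delta> > 0" "ball u0 \<delta> \<subseteq> Q" using Q(1) u0 open_contains_ball by blast
  \<comment> \<open>c bounds the norm of t a + s b relative to t when 0 \<le> s \<le> t; the summand
    1 keeps it positive if a and b vanish.\<close>
  define c where "c = norm a + norm b + 1"
  have c: "c > 0" unfolding c_def by (smt (verit) norm_ge_zero)
  have dist: "norm (t *\<^sub>R a + s *\<^sub>R b) \<le> t * c" if "0 \<le> s" "s \<le> t" for s t
  proof -
    have "norm (t *\<^sub>R a + s *\<^sub>R b) \<le> norm (t *\<^sub>R a) + norm (s *\<^sub>R b)" by (rule norm_triangle_ineq)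
    also have "\<dots> \<le> t * norm a + t * norm b" using that by (auto intro: mult_right_mono)
    also have "\<dots> \<le> t * c" using that by (simp add: c_def algebra_simps)
    finally show ?thesis .
  qed
  have inE: "?u t s \<in> E" for t s
    using E ab by (auto intro!: subspace_add subspace_scale)
  \<comment> \<open>Mean value theorem along the side in direction b, with the derivative of the
    \<tau>-coordinate given by the contact condition \<open>hor\<close>.\<close>
  have "\<exists>s. 0 < s \<and> s < t \<and> \<phi> (?u t t) $ Tc - \<phi> (u0 + t *\<^sub>R a) $ Tc
        = t * (symp (\<phi> (?u t s)) (?D (?u t s) b) / 2)" if t: "0 < t" "t < \<delta> / c" for t
  proof -
    have "\<exists>s>0. s < t \<and> \<phi> (?u t t) $ Tc - \<phi> (?u t 0) $ Tc
        = (t - 0) * (symp (\<phi> (?u t s)) (?D (?u t s) b) / 2)"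
    proof (rule MVT2[OF t(1)])
      fix s assume s: "0 \<le> s" "s \<le> t"
      have "norm (t *\<^sub>R a + s *\<^sub>R b) < \<delta>"
        using dist[OF s] t c by (simp add: field_simps)
      then have "dist u0 (?u t s) < \<delta>" by (simp add: dist_norm norm_minus_commute algebra_simps)
      then have "?u t s \<in> Q" using \<delta> by auto
      then have uEQ: "?u t s \<in> E \<inter> Q" using inE by auto
      have "((\<lambda>s. ?u t s) has_derivative (\<lambda>s. s *\<^sub>R b)) (at s)"
        by (auto intro!: derivative_eq_intros)
      from has_derivative_compose[OF this d[OF \<open>?u t s \<in> Q\<close>]]
      have "((\<lambda>s. \<phi> (?u t s) $ Tc) has_derivative (\<lambda>r. ?D (?u t s) (r *\<^sub>R b) $ Tc)) (at s)"
        by (rule bounded_linear.has_derivative[OF bounded_linear_vec_nth])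
      moreover have "(\<lambda>r. ?D (?u t s) (r *\<^sub>R b) $ Tc)
          = (*) (symp (\<phi> (?u t s)) (?D (?u t s) b) / 2)"
        using linear_scale[OF has_derivative_linear[OF d[OF \<open>?u t s \<in> Q\<close>]]] hor[OF uEQ ab(2)]
        by (auto simp: mult.commute)
      ultimately show "((\<lambda>s. \<phi> (?u t s) $ Tc) has_real_derivative
          symp (\<phi> (?u t s)) (?D (?u t s) b) / 2) (at s)"
        by (simp add: has_field_derivative_def)
    qed
    then show ?thesis by auto
  qed
  then obtain s where s: "\<And>t. 0 < t \<Longrightarrow> t < \<delta> / c \<Longrightarrow> 0 < s t \<and> s t < t
      \<and> \<phi> (?u t t) $ Tc - \<phi> (u0 + t *\<^sub>R a) $ Tc
        = t * (symp (\<phi> (?u t (s t))) (?D (?u t (s t)) b) / 2)"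
    by metis
  have ev: "eventually (\<lambda>t. 0 < t \<and> t < \<delta> / c) (at_right (0::real))"
    using \<delta> c by (auto simp: eventually_at_right intro!: exI[of _ "\<delta> / c"])
  define v where "v t = ?u t (s t)" for t
  have vlim: "(v \<longlongrightarrow> u0) (at_right 0)"
  proof (rule LIM_zero_cancel, rule Lim_transform_bound)
    show "eventually (\<lambda>t. norm (v t - u0) \<le> norm (t * c)) (at_right 0)"
      using ev
    proof eventually_elim
      case (elim t)
      then show ?case using dist[of "s t" t] s[of t] c
        by (simp add: v_def algebra_simps)
    qed
    show "((\<lambda>t. t * c) \<longlongrightarrow> 0) (at_right 0)"
      by (auto intro!: tendsto_eq_intros)
  qed
  define R where "R y = norm (\<phi> y - \<phi> u0 - A (y - u0)) / norm (y - u0)" for y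
  \<comment> \<open>\<open>R u0\<close> is 0 because division by zero yields 0. Thus
    \<open>R\<close> is continuous at u0, and composing it with v is allowed even where v t =
    u0.\<close>
  have "(R \<longlongrightarrow> R u0) (at u0)"
    using d[OF u0] unfolding has_derivative_iff_norm R_def A_def by simp
  then have Rlim: "((\<lambda>t. R (v t)) \<longlongrightarrow> 0) (at_right 0)"
    using isCont_tendsto_compose[OF _ vlim, of R] by (simp add: isCont_def R_def)
  have Dlim: "((\<lambda>t. ?D (v t) b) \<longlongrightarrow> A b) (at_right 0)"
    unfolding A_def by (rule isCont_tendsto_compose[OF isCont_frechet_derivative[OF Q u0] vlim])
  \<comment> \<open>The ratio s t / t need not converge, so the b-part of \<phi> (v t) / t is split
    off; what remains tends to A a.\<close>
  define w where "w t = (1 / t) *\<^sub>R \<phi> (v t) - (s t / t) *\<^sub>R A b" for t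
  have wlim: "(w \<longlongrightarrow> A a) (at_right 0)"
  proof (rule LIM_zero_cancel, rule Lim_transform_bound)
    show "eventually (\<lambda>t. norm (w t - A a) \<le> norm (R (v t) * c)) (at_right 0)"
      using ev
    proof eventually_elim
      case (elim t)
      have "A (v t - u0) = t *\<^sub>R A a + s t *\<^sub>R A b"
        by (simp add: v_def linear_add[OF linA] linear_scale[OF linA])
      then have "w t - A a = (1 / t) *\<^sub>R (\<phi> (v t) - \<phi> u0 - A (v t - u0))"
        using elim by (simp add: w_def 0 algebra_simps)
      then have "norm (w t - A a) = norm (\<phi> (v t) - \<phi> u0 - A (v t - u0)) / t"
        using elim by (simp only: norm_scaleR) simp
      also have "\<dots> = R (v t) * (norm (v t - u0) / t)"
        by (auto simp: R_def linear_0[OF linA])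
      also have "\<dots> \<le> R (v t) * c"
      proof (rule mult_left_mono)
        have "norm (v t - u0) \<le> t * c"
          using dist[of "s t" t] s[of t] elim by (simp add: v_def add.assoc)
        then show "norm (v t - u0) / t \<le> c" using elim by (simp add: field_simps)
      qed (simp add: R_def)
      finally show ?case by simp
    qed
    show "((\<lambda>t. R (v t) * c) \<longlongrightarrow> 0) (at_right 0)"
      using Rlim by (auto intro!: tendsto_eq_intros)
  qed
  \<comment> \<open>The part split off pairs A b with vectors tending to A b. This tends to 0 since
    \<open>symp\<close> is alternating, and s t / t stays bounded by 1.\<close>
  have corr: "((\<lambda>t. s t / t * symp (A b) (?D (v t) b)) \<longlongrightarrow> 0) (at_right 0)"
  proof (rule Lim_null_comparison)
    have "((\<lambda>t. symp (A b) (?D (v t) b)) \<longlongrightarrow> symp (A b) (A b)) (at_right 0)"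
      by (intro tendsto_intros Dlim)
    then show "((\<lambda>t. \<bar>symp (A b) (?D (v t) b)\<bar>) \<longlongrightarrow> 0) (at_right 0)"
      by (simp add: symp_self tendsto_rabs_zero)
    show "eventually (\<lambda>t. norm (s t / t * symp (A b) (?D (v t) b)) \<le> \<bar>symp (A b) (?D (v t) b)\<bar>)
      (at_right 0)"
      using ev
    proof eventually_elim
      case (elim t)
      then have "\<bar>s t / t\<bar> \<le> 1" using s[of t] by simp
      then show ?case unfolding real_norm_def abs_mult
        by (intro mult_left_le_one_le) auto
    qed
  qed
  have "((\<lambda>t. (symp (w t) (?D (v t) b) + s t / t * symp (A b) (?D (v t) b)) / 2)
      \<longlongrightarrow> (symp (A a) (A b) + 0) / 2) (at_right 0)"
    by (intro tendsto_intros wlim Dlim corr) auto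
  moreover have "eventually (\<lambda>t. (symp (w t) (?D (v t) b) + s t / t * symp (A b) (?D (v t) b)) / 2
     = (\<phi> (?u t t) $ Tc - \<phi> (u0 + t *\<^sub>R a) $ Tc) / t\<^sup>2) (at_right 0)"
    using ev
  proof eventually_elim
    case (elim t)
    have "symp (w t) (?D (v t) b) + s t / t * symp (A b) (?D (v t) b)
        = symp (\<phi> (v t)) (?D (v t) b) / t"
      by (simp add: w_def linear_diff[OF symp_linear(1)] linear_scale[OF symp_linear(1)])
    moreover have "\<phi> (?u t t) $ Tc - \<phi> (u0 + t *\<^sub>R a) $ Tc
        = t * (symp (\<phi> (v t)) (?D (v t) b) / 2)"
      using s[of t] elim by (simp only: v_def)
    ultimately show ?case using elim by (simp only:) (simp add: power2_eq_square)
  qed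
  ultimately have "((\<lambda>t. (\<phi> (?u t t) $ Tc - \<phi> (u0 + t *\<^sub>R a) $ Tc) / t\<^sup>2)
      \<longlongrightarrow> (symp (A a) (A b) + 0) / 2) (at_right 0)"
    by (rule Lim_transform_eventually)
  then show ?thesis by (simp only: add_0_right)
qed

text \<open>The integral manifold through the origin suffices, because left invariant fields take
  their own coordinates as values there. The \<tau>-coordinate is o(t^2) at u0 + t a and at u0 + t
  (a + b), whereas the difference of these two values is t^2 \<open>symp (?A a) (?A b)\<close> / 2
  to second order.\<close>

lemma integrable_fields_isotropic:
  assumes "integrable_fields ws" and hor: "set ws \<subseteq> horizontal_layer"
  shows "isotropic (set ws)"
proof -
  obtain E :: "(real ^ 'a) set" and Q \<phi> u0 where E: "subspace E" and Q: "open Q" "smooth_on Q \<phi>"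
    and u0: "u0 \<in> E \<inter> Q" and 0: "\<phi> u0 = 0"
    and im: "\<And>u. u\<in>E \<inter> Q \<Longrightarrow>
      frechet_derivative \<phi> (at u) ` E = (\<lambda>w. left_field w (\<phi> u)) ` span (set ws)"
    using assms(1) unfolding integrable_fields_def by metis
  have "subspace (horizontal_layer :: 'a heis set)"
    by (auto simp: subspace_def horizontal_layer_def)
  then have span: "span (set ws) \<subseteq> horizontal_layer" using hor by (rule span_minimal[rotated])
  have hd: "frechet_derivative \<phi> (at u) e $ Tc = symp (\<phi> u) (frechet_derivative \<phi> (at u) e) / 2"
    if *: "u \<in> E \<inter> Q" "e \<in> E" for u e
  proof -
    obtain w where "w \<in> span (set ws)" "frechet_derivative \<phi> (at u) e = left_field w (\<phi> u)"
      using im[OF *(1)] *(2) by blast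
    then show ?thesis using span by (auto simp: horizontal_layer_def)
  qed
  let ?A = "frechet_derivative \<phi> (at u0)"
  have diff: "((\<lambda>t. (\<phi> (u0 + t *\<^sub>R a + t *\<^sub>R b) $ Tc - \<phi> (u0 + t *\<^sub>R a) $ Tc) / t\<^sup>2)
    \<longlongrightarrow> symp (?A a) (?A b) / 2) (at_right 0)" if "a \<in> E" "b \<in> E" for a b
    using that by (intro horizontal_second_difference[OF Q E u0 0] hd)
  \<comment> \<open>The case a = 0 of \<open>diff\<close>: the side then starts at u0, where \<phi>
    vanishes.\<close>
  have z: "((\<lambda>t. \<phi> (u0 + t *\<^sub>R b) $ Tc / t\<^sup>2) \<longlongrightarrow> 0) (at_right 0)" if "b \<in> E" for b
  proof -
    have "\<phi> differentiable (at u0)" using Q(2) u0 unfolding smooth_on_def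
      by (metis IntD2 empty_set empty_subsetI iter_deriv.simps(1))
    then have "?A 0 = 0" by (intro linear_0 linear_frechet_derivative)
    then show ?thesis
      using diff[OF subspace_0[OF E] that] by (simp add: 0 linear_0[OF symp_linear(1)])
  qed
  have iso: "symp (?A a) (?A b) = 0" if ab: "a \<in> E" "b \<in> E" for a b
  proof -
    have "((\<lambda>t. \<phi> (u0 + t *\<^sub>R (a + b)) $ Tc / t\<^sup>2 - \<phi> (u0 + t *\<^sub>R a) $ Tc / t\<^sup>2) \<longlongrightarrow> 0 - 0) (at_right 0)"
      by (intro tendsto_diff z ab subspace_add[OF E])
    then have "((\<lambda>t. (\<phi> (u0 + t *\<^sub>R a + t *\<^sub>R b) $ Tc - \<phi> (u0 + t *\<^sub>R a) $ Tc) / t\<^sup>2)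
        \<longlongrightarrow> 0) (at_right 0)"
      by (simp add: diff_divide_distrib scaleR_add_right add.assoc)
    from tendsto_unique[OF _ this diff[OF ab]] show ?thesis by simp
  qed
  show ?thesis unfolding isotropic_def
  proof (intro ballI)
    fix v w assume "v \<in> set ws" "w \<in> set ws"
    then have "left_field v 0 \<in> ?A ` E" "left_field w 0 \<in> ?A ` E"
      unfolding im[OF u0] 0 by (auto intro: span_base)
    then obtain a b where "a \<in> E" "b \<in> E" "left_field v 0 = ?A a" "left_field w 0 = ?A b"
      by blast
    then show "symp v w = 0" using iso[of a b] symp_left_field(1)[of v 0 w 0] by simp
  qed
qed


section \<open>Smooth functions\<close>

lemma iter_deriv_snoc:
  "iter_deriv (vs @ [v]) f = iter_deriv vs (\<lambda>p. frechet_derivative f (at p) v)"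
  by (induction vs) auto

lemma frechet_derivative_cong_open:
  assumes "open U" "p \<in> U" "\<And>q. q \<in> U \<Longrightarrow> f q = g q"
  shows "frechet_derivative f (at p) = frechet_derivative g (at p)"
proof -
  have "(f has_derivative D) (at p) \<longleftrightarrow> (g has_derivative D) (at p)" for D
    using has_derivative_transform_within_open[OF _ assms(1,2)] assms(3) by metis
  then show ?thesis by (simp add: frechet_derivative_def)
qed

lemma differentiable_cong_open:
  assumes "open U" "p \<in> U" "\<And>q. q \<in> U \<Longrightarrow> f q = g q" "f differentiable (at p)"
  shows "g differentiable (at p)"
  using assms has_derivative_transform_within_open[OF _ assms(1,2)]
  unfolding differentiable_def by metis

lemma iter_deriv_cong_open:
  assumes "open U" "p \<in> U" "\<And>q. q \<in> U \<Longrightarrow> f q = g q"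
  shows "iter_deriv vs f p = iter_deriv vs g p"
  using assms(2)
proof (induction vs arbitrary: p)
  case (Cons v vs)
  then show ?case
    using frechet_derivative_cong_open[OF assms(1), of p "iter_deriv vs f" "iter_deriv vs g"] by simp
qed (use assms in auto)

text \<open>\<open>smooth_on\<close> graded by the order, so that the Leibniz rule can be iterated
  by induction. \<open>Cn_on_Suc\<close> peels off the innermost derivative, the last entry of the
  list.\<close>

definition Cn_on :: "nat \<Rightarrow> 'a::euclidean_space set \<Rightarrow> ('a \<Rightarrow> 'b::real_normed_vector) \<Rightarrow> bool" where
  "Cn_on n U f \<longleftrightarrow> (\<forall>vs. set vs \<subseteq> Basis \<longrightarrow> length vs \<le> n \<longrightarrow>
     (\<forall>p\<in>U. iter_deriv vs f differentiable (at p)))"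

lemma smooth_on_iff_Cn: "smooth_on U f \<longleftrightarrow> (\<forall>n. Cn_on n U f)"
  unfolding smooth_on_def Cn_on_def by blast

lemma Cn_on_0: "Cn_on 0 U f \<longleftrightarrow> (\<forall>p\<in>U. f differentiable (at p))"
  by (auto simp: Cn_on_def)

lemma Cn_on_Suc:
  fixes f :: "'a::euclidean_space \<Rightarrow> 'b::real_normed_vector"
  shows "Cn_on (Suc n) U f \<longleftrightarrow> (\<forall>p\<in>U. f differentiable (at p)) \<and>
    (\<forall>v\<in>Basis. Cn_on n U (\<lambda>p. frechet_derivative f (at p) v))"
  (is "?l \<longleftrightarrow> ?r")
proof
  assume l: ?l
  then have "\<forall>p\<in>U. f differentiable (at p)"
    unfolding Cn_on_def by (metis empty_set empty_subsetI iter_deriv.simps(1) le0 list.size(3))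
  moreover have "iter_deriv vs (\<lambda>p. frechet_derivative f (at p) v) differentiable (at p)"
    if "v \<in> Basis" "set vs \<subseteq> Basis" "length vs \<le> n" "p \<in> U" for v vs p
    using l[unfolded Cn_on_def, rule_format, of "vs @ [v]" p] that by (simp add: iter_deriv_snoc)
  ultimately show ?r by (auto simp: Cn_on_def)
next
  assume r: ?r
  show ?l unfolding Cn_on_def
  proof (intro allI impI ballI)
    fix vs :: "'a list" and p assume vs: "set vs \<subseteq> Basis" "length vs \<le> Suc n" and p: "p \<in> U"
    show "iter_deriv vs f differentiable (at p)"
    proof (cases vs rule: rev_cases)
      case (snoc ws v)
      then show ?thesis using r vs p by (auto simp: iter_deriv_snoc Cn_on_def)
    qed (use r p in auto)
  qed
qed

lemma Cn_on_mono: "Cn_on (Suc n) U f \<Longrightarrow> Cn_on n U f"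
  by (auto simp: Cn_on_def)

lemma Cn_on_cong:
  fixes f g :: "'a::euclidean_space \<Rightarrow> 'b::real_normed_vector"
  assumes "open U" "\<And>q. q \<in> U \<Longrightarrow> f q = g q" "Cn_on n U f"
  shows "Cn_on n U g"
  unfolding Cn_on_def
proof (intro allI impI ballI)
  fix vs :: "'a list" and p assume *: "set vs \<subseteq> Basis" "length vs \<le> n" "p \<in> U"
  show "iter_deriv vs g differentiable (at p)"
    by (rule differentiable_cong_open[OF assms(1), of p "iter_deriv vs f"])
       (use * assms(3) iter_deriv_cong_open[OF assms(1) _ assms(2), where vs=vs] in \<open>auto simp: Cn_on_def\<close>)
qed

lemma Cn_on_const: "Cn_on n U (\<lambda>_. c)"
  by (induction n arbitrary: c) (simp_all add: Cn_on_0 Cn_on_Suc)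

lemma Cn_on_add:
  assumes "open U"
  shows "Cn_on n U f \<Longrightarrow> Cn_on n U g \<Longrightarrow> Cn_on n U (\<lambda>x. f x + g x)"
proof (induction n arbitrary: f g)
  case 0
  then show ?case by (simp add: Cn_on_0)
next
  case (Suc n)
  have "Cn_on n U (\<lambda>p. frechet_derivative (\<lambda>x. f x + g x) (at p) v)" if "v \<in> Basis" for v
  proof (rule Cn_on_cong[OF assms])
    show "Cn_on n U (\<lambda>p. frechet_derivative f (at p) v + frechet_derivative g (at p) v)"
      using Suc that by (intro Suc.IH) (auto simp: Cn_on_Suc)
    fix p assume "p \<in> U"
    then have d: "(f has_derivative frechet_derivative f (at p)) (at p)"
      "(g has_derivative frechet_derivative g (at p)) (at p)"
      using Suc.prems by (auto simp: Cn_on_Suc frechet_derivative_works[symmetric])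
    show "frechet_derivative f (at p) v + frechet_derivative g (at p) v
        = frechet_derivative (\<lambda>x. f x + g x) (at p) v"
      using frechet_derivative_at[OF has_derivative_add[OF d]] by metis
  qed
  then show ?case using Suc.prems by (simp add: Cn_on_Suc)
qed

lemma Cn_on_scaleR:
  fixes f :: "'a::euclidean_space \<Rightarrow> real" and g :: "'a \<Rightarrow> 'b::real_normed_vector"
  assumes "open U"
  shows "Cn_on n U f \<Longrightarrow> Cn_on n U g \<Longrightarrow> Cn_on n U (\<lambda>x. f x *\<^sub>R g x)"
proof (induction n arbitrary: f g)
  case 0
  then show ?case by (simp add: Cn_on_0)
next
  case (Suc n)
  have "Cn_on n U (\<lambda>p. frechet_derivative (\<lambda>x. f x *\<^sub>R g x) (at p) v)" if v: "v \<in> Basis" for v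
  proof (rule Cn_on_cong[OF assms])
    show "Cn_on n U (\<lambda>p. f p *\<^sub>R frechet_derivative g (at p) v + frechet_derivative f (at p) v *\<^sub>R g p)"
      using Suc.prems[THEN Cn_on_mono] Suc.prems v
      by (intro Cn_on_add[OF assms] Suc.IH) (auto simp: Cn_on_Suc)
    fix p assume "p \<in> U"
    then have d: "(f has_derivative frechet_derivative f (at p)) (at p)"
      "(g has_derivative frechet_derivative g (at p)) (at p)"
      using Suc.prems by (auto simp: Cn_on_Suc frechet_derivative_works[symmetric])
    show "f p *\<^sub>R frechet_derivative g (at p) v + frechet_derivative f (at p) v *\<^sub>R g p
        = frechet_derivative (\<lambda>x. f x *\<^sub>R g x) (at p) v"
      using frechet_derivative_at[OF has_derivative_scaleR[OF d]] by metis
  qed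
  moreover have "\<forall>p\<in>U. (\<lambda>x. f x *\<^sub>R g x) differentiable (at p)"
    using Suc.prems by (simp add: Cn_on_Suc)
  ultimately show ?case by (simp add: Cn_on_Suc)
qed

lemma Cn_on_prod:
  assumes "open U" "finite I" "\<And>i. i \<in> I \<Longrightarrow> Cn_on n U (f i)"
  shows "Cn_on n U (\<lambda>x. \<Prod>i\<in>I. f i x :: real)"
  using assms(2,3)
proof (induction I)
  case (insert i I)
  then show ?case using Cn_on_scaleR[OF assms(1), of n "f i" "\<lambda>x. \<Prod>i\<in>I. f i x"] by simp
qed (simp add: Cn_on_const)

section \<open>Smooth bumps converging to indicators of open boxes\<close>

definition flat :: "nat \<Rightarrow> real \<Rightarrow> real" where
  "flat m x = (if x \<le> 0 then 0 else exp (- inverse x) * inverse x ^ m)"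

lemma flat_tendsto_0: "(flat m \<longlongrightarrow> 0) (at 0)"
proof (rule filterlim_split_at)
  show "(flat m \<longlongrightarrow> 0) (at_left 0)"
    by (rule tendsto_eventually) (auto simp: flat_def eventually_at_left_field intro: exI[of _ "-1"])
  have "((\<lambda>x. (inverse x) ^ m / exp (inverse x)) \<longlongrightarrow> (0::real)) (at_right 0)"
    by (rule filterlim_compose[OF tendsto_power_div_exp_0 filterlim_inverse_at_top_right])
  moreover have "eventually (\<lambda>x. inverse x ^ m / exp (inverse x) = flat m x) (at_right (0::real))"
    by (auto simp: eventually_at_right_field flat_def exp_minus field_simps intro!: exI[of _ 1])
  ultimately show "(flat m \<longlongrightarrow> 0) (at_right 0)" by (rule Lim_transform_eventually)
qed

text \<open>The powers of 1/x are carried along because they make the family closed under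
  differentiation; \<open>flat 0\<close> is the usual exp(-1/x).\<close>

lemma flat_deriv: "(flat m has_real_derivative flat (m + 2) x - real m * flat (m + 1) x) (at x)"
proof -
  consider "x < 0" | "x > 0" | "x = 0" by linarith
  then show ?thesis
  proof cases
    case 1
    have "((\<lambda>_. 0) has_real_derivative 0) (at x)" by simp
    then have "(flat m has_real_derivative 0) (at x)"
      by (rule has_field_derivative_transform_within_open[of _ _ _ "{..<0}"])
         (use 1 in \<open>auto simp: flat_def\<close>)
    then show ?thesis using 1 by (simp add: flat_def)
  next
    case 2
    have "((\<lambda>x. exp (- inverse x) * inverse x ^ m) has_real_derivative
        flat (m + 2) x - real m * flat (m + 1) x) (at x)"
      using 2 by (cases m) (auto intro!: derivative_eq_intros
        simp: flat_def power2_eq_square field_simps, metis One_nat_def power_eq_if)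
    then show ?thesis
      by (rule has_field_derivative_transform_within_open[of _ _ _ "{0<..}"])
         (use 2 in \<open>auto simp: flat_def\<close>)
  next
    case 3
    \<comment> \<open>At 0 the difference quotient of \<open>flat m\<close> is again a member of the
      family, \<open>flat (Suc m)\<close>.\<close>
    have "((\<lambda>h. (flat m (0 + h) - flat m 0) / h) \<longlongrightarrow> 0) (at 0)"
    proof (rule Lim_transform_eventually[OF flat_tendsto_0[of "Suc m"]])
      show "eventually (\<lambda>h. flat (Suc m) h = (flat m (0 + h) - flat m 0) / h) (at 0)"
        by (auto simp: eventually_at flat_def divide_inverse intro!: exI[of _ 1])
    qed
    then show ?thesis using 3 by (simp add: DERIV_def flat_def)
  qed
qed

lemma Cn_on_flat_affine:
  assumes "open U"
  shows "Cn_on n U (\<lambda>x::'a::euclidean_space. flat m (c * (x \<bullet> i) + d))"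
proof (induction n arbitrary: m)
  have D: "((\<lambda>x. flat m (c * (x \<bullet> i) + d)) has_derivative
      (\<lambda>v. (flat (m + 2) (c * (p \<bullet> i) + d) - real m * flat (m + 1) (c * (p \<bullet> i) + d)) * (c * (v \<bullet> i))))
      (at p)" for p and m
  proof -
    have "((\<lambda>x. c * (x \<bullet> i) + d) has_derivative (\<lambda>v. c * (v \<bullet> i))) (at p)"
      by (auto intro!: derivative_eq_intros)
    from has_derivative_compose[OF this flat_deriv[of m, unfolded has_field_derivative_def]]
    show ?thesis .
  qed
  {
    case 0
    show ?case using D by (auto simp: Cn_on_0 differentiable_def)
  next
    case (Suc n)
    have "Cn_on n U (\<lambda>p. frechet_derivative (\<lambda>x. flat m (c * (x \<bullet> i) + d)) (at p) v)" for v
    proof -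
      have "Cn_on n U (\<lambda>p. (c * (v \<bullet> i)) *\<^sub>R (flat (m + 2) (c * (p \<bullet> i) + d)
          + (- real m) *\<^sub>R flat (m + 1) (c * (p \<bullet> i) + d)))"
        by (intro Cn_on_scaleR Cn_on_add Cn_on_const assms Suc.IH)
      moreover have "(\<lambda>p. frechet_derivative (\<lambda>x. flat m (c * (x \<bullet> i) + d)) (at p) v)
        = (\<lambda>p. (c * (v \<bullet> i)) *\<^sub>R (flat (m + 2) (c * (p \<bullet> i) + d)
          + (- real m) *\<^sub>R flat (m + 1) (c * (p \<bullet> i) + d)))"
        by (subst frechet_derivative_at[OF D, symmetric]) (simp add: fun_eq_iff algebra_simps)
      ultimately show ?thesis by simp
    qed
    then show ?case using D by (auto simp: Cn_on_Suc differentiable_def)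
  }
qed

text \<open>The parameter n sits inside \<open>flat\<close>: each factor exp(-1/(n y)) with y > 0
  tends to 1 while the bounds 0 and 1 are kept.\<close>

definition box_bump :: "'a::euclidean_space \<Rightarrow> 'a \<Rightarrow> nat \<Rightarrow> 'a \<Rightarrow> real" where
  "box_bump a b n x = (\<Prod>i\<in>Basis. flat 0 (real n * (x \<bullet> i - a \<bullet> i)) * flat 0 (real n * (b \<bullet> i - x \<bullet> i)))"

lemma Cn_on_box_bump:
  assumes "open U"
  shows "Cn_on k U (box_bump a b n)"
proof -
  have "Cn_on k U (\<lambda>x. flat 0 (real n * (x \<bullet> i) + - real n * (a \<bullet> i))
      *\<^sub>R flat 0 (- real n * (x \<bullet> i) + real n * (b \<bullet> i)))" for i
    by (intro Cn_on_scaleR Cn_on_flat_affine assms)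
  then have "Cn_on k U (\<lambda>x. \<Prod>i\<in>Basis. flat 0 (real n * (x \<bullet> i) + - real n * (a \<bullet> i))
      *\<^sub>R flat 0 (- real n * (x \<bullet> i) + real n * (b \<bullet> i)))"
    by (intro Cn_on_prod assms) auto
  then show ?thesis by (simp add: box_bump_def[abs_def] right_diff_distrib)
qed

lemma flat_0_bounds: "0 \<le> flat 0 x" "flat 0 x \<le> 1"
  by (simp_all add: flat_def)

lemma box_bump_bounds: "0 \<le> box_bump a b n x" "box_bump a b n x \<le> 1"
  unfolding box_bump_def
  by (auto intro!: prod_nonneg prod_le_1 mult_nonneg_nonneg mult_le_one flat_0_bounds)

lemma box_bump_eq_0: "x \<notin> box a b \<Longrightarrow> box_bump a b n x = 0"
  by (auto simp: box_bump_def mem_box flat_def mult_le_0_iff not_less)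

lemma box_bump_tendsto: "(\<lambda>n. box_bump a b n x) \<longlonglongrightarrow> indicator (box a b) x"
proof (cases "x \<in> box a b")
  case True
  have flat: "(\<lambda>n. flat 0 (real n * y)) \<longlonglongrightarrow> 1" if "y > 0" for y
  proof (rule Lim_transform_eventually)
    have "(\<lambda>n. exp (- (inverse y * inverse (real n)))) \<longlonglongrightarrow> exp (- (inverse y * 0))"
      by (intro tendsto_intros lim_inverse_n)
    then show "(\<lambda>n. exp (- (inverse y * inverse (real n)))) \<longlonglongrightarrow> 1" by simp
    show "\<forall>\<^sub>F n in sequentially. exp (- (inverse y * inverse (real n))) = flat 0 (real n * y)"
      using eventually_gt_at_top[of 0]
      by eventually_elim (use that in \<open>auto simp: flat_def mult_le_0_iff mult.commute\<close>)
  qed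
  have "(\<lambda>n. box_bump a b n x) \<longlonglongrightarrow> (\<Prod>i\<in>(Basis::'a set). 1 * 1)"
    unfolding box_bump_def using True by (intro tendsto_prod tendsto_mult flat) (auto simp: mem_box)
  then show ?thesis using True by simp
qed (simp add: box_bump_eq_0)


section \<open>Densities that vanish almost everywhere\<close>

text \<open>Borel sets need not be shown to be measurable for \<open>M\<close>: the hypothesis on \<open>\<psi>\<close> makes their
  traces on \<open>{g \<noteq> 0}\<close> measurable, and the hull property compares these traces with arbitrary
  measurable sets.\<close>

lemma AE_eq_0_of_box_approx:
  fixes g :: "'a::euclidean_space \<Rightarrow> real" and \<psi> :: "'a \<Rightarrow> 'a \<Rightarrow> nat \<Rightarrow> 'a \<Rightarrow> real"
  assumes space: "space M = UNIV" and g: "integrable M g"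
    and hull: "\<And>A. A \<in> sets M \<Longrightarrow> emeasure M A < \<infinity> \<Longrightarrow>
        \<exists>B\<in>sets borel. A \<subseteq> B \<and> (\<forall>C\<in>sets M. C \<subseteq> B \<longrightarrow> emeasure M C \<le> emeasure M A)"
    and fin: "emeasure M {x. g x \<noteq> 0} < \<infinity>"
    and \<psi>: "\<And>a b n x. 0 \<le> \<psi> a b n x" "\<And>a b n x. \<psi> a b n x \<le> 1"
      "\<And>a b x. (\<lambda>n. \<psi> a b n x) \<longlonglongrightarrow> indicator (box a b) x"
    and ortho: "\<And>a b n. box a b \<subseteq> box a0 b0 \<Longrightarrow> has_bochner_integral M (\<lambda>x. \<psi> a b n x * g x) 0"
  shows "AE x in M. x \<in> box a0 b0 \<longrightarrow> g x = 0"
proof -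
  let ?Q = "box a0 b0"
  let ?P = "\<lambda>A. has_bochner_integral M (\<lambda>x. indicator (A \<inter> ?Q) x * g x) 0"
  have gm: "g \<in> borel_measurable M" using g by auto
  \<comment> \<open>Dominated convergence with majorant |g|. Measurability is asked only of the
    products with g.\<close>
  have conv: "has_bochner_integral M f 0"
    if m: "\<And>n. has_bochner_integral M (\<lambda>x. u n x * g x) 0"
      and b: "\<And>n x. 0 \<le> u n x" "\<And>n x. u n x \<le> 1" and l: "\<And>x. (\<lambda>n. u n x * g x) \<longlonglongrightarrow> f x"
    for u :: "nat \<Rightarrow> 'a \<Rightarrow> real" and f
  proof -
    have um: "(\<lambda>x. u n x * g x) \<in> borel_measurable M" for n
      using m[of n] by (simp add: has_bochner_integral_iff borel_measurable_integrable)
    have fm: "f \<in> borel_measurable M"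
      by (rule borel_measurable_LIMSEQ_real[OF l um])
    have bd: "norm (u n x * g x) \<le> \<bar>g x\<bar>" for n x
      using b[of n x] by (simp add: abs_mult mult_left_le_one_le)
    have "integrable M f"
      by (rule integrable_dominated_convergence[OF fm um _ AE_I2[OF l] AE_I2[OF bd]]) (use g in auto)
    moreover have "(\<lambda>n. integral\<^sup>L M (\<lambda>x. u n x * g x)) \<longlonglongrightarrow> integral\<^sup>L M f"
      by (rule integral_dominated_convergence[OF fm um _ AE_I2[OF l] AE_I2[OF bd]]) (use g in auto)
    moreover have "integral\<^sup>L M (\<lambda>x. u n x * g x) = 0" for n
      using m[of n] by (simp add: has_bochner_integral_iff)
    ultimately show ?thesis by (simp add: has_bochner_integral_iff LIMSEQ_const_iff)
  qed
  have box: "?P (box a b)" for a b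
  proof -
    obtain c d where cd: "box a b \<inter> ?Q = box c d" using that[OF box_Int_box] by blast
    then have "box c d \<subseteq> ?Q" by auto
    then show ?thesis unfolding cd
      by (rule conv[OF ortho \<psi>(1,2) tendsto_mult[OF \<psi>(3) tendsto_const]])
  qed
  \<comment> \<open>Dynkin's theorem for the intersection-stable family of open boxes, with all sets
    traced on the fixed box \<open>?Q\<close>.\<close>
  have borel: "?P A" if "A \<in> sets borel" for A
  proof -
    have eq: "sets (borel :: 'a measure) = sigma_sets UNIV (range (\<lambda>(a, b). box a b))"
      by (subst borel_eq_box) simp
    have "Int_stable (range (\<lambda>(a, b). box a b :: 'a set))"
      unfolding Int_stable_def by (auto simp: box_Int_box)
    moreover have "range (\<lambda>(a, b). box a b :: 'a set) \<subseteq> Pow UNIV" by auto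
    moreover have "A \<in> sigma_sets UNIV (range (\<lambda>(a, b). box a b))" using that eq by simp
    ultimately show ?thesis
    proof (induction rule: sigma_sets_induct_disjoint)
      case (basic A)
      then show ?case using box by auto
    next
      case empty
      then show ?case by (simp add: has_bochner_integral_zero)
    next
      case (compl A)
      have "?P ?Q" using box[of a0 b0] by simp
      from has_bochner_integral_diff[OF this compl(2)]
      show ?case
        by (rule has_bochner_integral_cong[THEN iffD1, rotated 3]) (auto simp: indicator_def)
    next
      case (union A)
      have fin_un: "?P (\<Union>i<n. A i)" for n
      proof (induction n)
        case (Suc n)
        from has_bochner_integral_add[OF Suc union(3)[of n]]
        show ?case
        proof (rule has_bochner_integral_cong[THEN iffD1, rotated 3])
          fix x
          have "x \<notin> A i" if "x \<in> A n" "i < n" for i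
            using disjoint_family_onD[OF union(1), of i n] that by auto
          then show "indicator ((\<Union>i<n. A i) \<inter> ?Q) x * g x + indicator (A n \<inter> ?Q) x * g x
              = indicator ((\<Union>i<Suc n. A i) \<inter> ?Q) x * g x"
            by (auto simp: indicator_def lessThan_Suc)
        qed auto
      qed (simp add: has_bochner_integral_zero)
      show ?case
      proof (rule conv[OF fin_un])
        fix x
        have "(\<lambda>n. indicator (\<Union>i<n. A i) x :: real) \<longlonglongrightarrow> indicator (\<Union>i. A i) x"
          by (rule LIMSEQ_indicator_UN)
        then show "(\<lambda>n. indicator ((\<Union>i<n. A i) \<inter> ?Q) x * g x)
            \<longlonglongrightarrow> indicator (\<Union> (range A) \<inter> ?Q) x * g x"
          by (auto simp: indicator_inter_arith intro!: tendsto_intros)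
      qed (auto simp: indicator_def)
    qed
  qed
  have half: "AE x in M. \<not> (x \<in> ?Q \<and> 0 < s * g x)" if s: "s = 1 \<or> s = -1" for s :: real
  proof -
    let ?f = "\<lambda>B x. indicator (B \<inter> ?Q) x * (s * g x)"
    have P: "has_bochner_integral M (?f B) 0" if "B \<in> sets borel" for B
      using has_bochner_integral_mult_right[OF borel[OF that], of s] by (simp add: mult.left_commute)
    have fm: "?f B \<in> borel_measurable M" if "B \<in> sets borel" for B
      using P[OF that] by (simp add: has_bochner_integral_iff borel_measurable_integrable)
    define A where "A = {x\<in>space M. 0 < ?f UNIV x}"
    have A: "A \<in> sets M" unfolding A_def using fm[of UNIV] by simp
    have Aeq: "A = {x. x \<in> ?Q \<and> 0 < s * g x}" by (auto simp: A_def space indicator_def)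
    have "{x\<in>space M. g x \<noteq> 0} \<in> sets M" using gm by measurable
    then have gs: "{x. g x \<noteq> 0} \<in> sets M" by (simp add: space)
    have "emeasure M A \<le> emeasure M {x. g x \<noteq> 0}"
      using gs by (intro emeasure_mono) (auto simp: Aeq)
    then have Afin: "emeasure M A < \<infinity>" using fin by (rule le_less_trans)
    obtain B where B: "B \<in> sets borel" "A \<subseteq> B"
      "\<And>C. C \<in> sets M \<Longrightarrow> C \<subseteq> B \<Longrightarrow> emeasure M C \<le> emeasure M A"
      using hull[OF A Afin] by blast
    define D where "D = {x\<in>space M. ?f B x < 0}"
    have D: "D \<in> sets M" unfolding D_def using fm[OF B(1)] by simp
    have disj: "A \<inter> D = {}" and DB: "D \<subseteq> B"
      by (auto simp: Aeq D_def indicator_def split: if_splits)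
    \<comment> \<open>A and D are the parts of the hull B inside the box where s g is positive and
      negative. Their union lies in B, so its measure is at most that of A, and finiteness forces D
      to be null. On B the integrand is then nonnegative almost everywhere with integral
      zero.\<close>
    have "emeasure M A + emeasure M D = emeasure M (A \<union> D)"
      by (rule plus_emeasure[OF A D disj])
    also have "\<dots> \<le> emeasure M A + 0" using A D B DB by auto
    finally have "emeasure M D = 0" using Afin
      by (auto simp: ennreal_add_left_cancel_le)
    then have "D \<in> null_sets M" using D by auto
    then have "AE x in M. x \<notin> D" by (rule AE_not_in)
    then have "AE x in M. 0 \<le> ?f B x" by (auto simp: D_def space not_less)
    moreover have "integrable M (?f B)" "integral\<^sup>L M (?f B) = 0"
      using P[OF B(1)] by (auto simp: has_bochner_integral_iff)
    ultimately have "AE x in M. ?f B x = 0"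
      using integral_nonneg_eq_0_iff_AE by blast
    then show ?thesis
    proof eventually_elim
      case (elim x)
      show ?case
      proof
        assume *: "x \<in> ?Q \<and> 0 < s * g x"
        then have "x \<in> B" using B(2) Aeq by auto
        with * elim show False by (auto simp: indicator_def)
      qed
    qed
  qed
  have "AE x in M. \<not> (x \<in> ?Q \<and> 0 < g x)" "AE x in M. \<not> (x \<in> ?Q \<and> g x < 0)"
    using half[of 1] half[of "-1"] by simp_all
  then show ?thesis by eventually_elim (meson linorder_neqE_linordered_idom)
qed

section \<open>Borel hulls for the spherical measure\<close>

lemma closed_hball: "closed (hball p r)"
proof -
  have "continuous_on UNIV (\<lambda>q. hmult (- p) q $ i)" for i
    by (cases i) (auto simp: hmult_def intro!: continuous_intros)
  from continuous_on_vec_lambda[of UNIV "\<lambda>i q. hmult (- p) q $ i", OF this] have "continuous_on UNIV (hmult (- p))" by simp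
  then have "continuous_on UNIV (hdist p)"
    unfolding hdist_def[abs_def] hnorm_def by (auto intro!: continuous_intros)
  then show ?thesis
    unfolding hball_def by (intro closed_Collect_le continuous_on_const)
qed

lemma spherical_premeasure_mono: "A \<subseteq> B \<Longrightarrow> spherical_premeasure m \<delta> A \<le> spherical_premeasure m \<delta> B"
  unfolding spherical_premeasure_def by (rule INF_superset_mono) auto

lemma spherical_premeasure_antimono:
  "\<delta> \<le> \<epsilon> \<Longrightarrow> spherical_premeasure m \<epsilon> A \<le> spherical_premeasure m \<delta> A"
  unfolding spherical_premeasure_def by (rule INF_superset_mono) (auto intro: order_trans)

lemma spherical_outer_mono: "A \<subseteq> B \<Longrightarrow> spherical_outer m A \<le> spherical_outer m B"
  unfolding spherical_outer_def by (intro SUP_mono) (auto intro: spherical_premeasure_mono)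

text \<open>The hull is the intersection over n of unions of closed balls from nearly optimal covers
  of A; each of these covers also covers the hull.\<close>

lemma spherical_outer_hull:
  fixes A :: "'n::finite heis set"
  assumes fin: "spherical_outer m A < \<infinity>"
  shows "\<exists>B\<in>sets borel. A \<subseteq> B \<and> spherical_outer m B \<le> spherical_outer m A"
proof -
  let ?d = "\<lambda>n. 1 / real (Suc n)"
  let ?S = "\<lambda>r :: nat \<Rightarrow> real. \<Sum>i. ennreal (unit_ball_vol (real m) * r i ^ m)"
  have le: "spherical_premeasure m (?d n) A \<le> spherical_outer m A" for n
    unfolding spherical_outer_def by (rule SUP_upper) auto
  \<comment> \<open>1/(n+1) bounds the diameters and is also the slack over the outer measure, as
    the infimum over covers need not be attained.\<close>
  define near_opt where "near_opt n c r \<longleftrightarrow> (\<forall>i. 0 \<le> r i \<and> 2 * r i \<le> ?d n)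
      \<and> A \<subseteq> (\<Union>i. hball (c i) (r i)) \<and> ?S r < spherical_outer m A + ennreal (?d n)"
    for n and c :: "nat \<Rightarrow> 'n heis" and r
  have "\<exists>c r. near_opt n c r" for n
  proof -
    have "spherical_premeasure m (?d n) A < spherical_outer m A + ennreal (?d n)"
      using le[of n] fin
      by (metis add.right_neutral ennreal_add_left_cancel_less ennreal_less_zero_iff
          infinity_ennreal_def le_less_trans of_nat_0_less_iff zero_less_Suc zero_less_divide_1_iff)
    then show ?thesis
      unfolding spherical_premeasure_def near_opt_def by (auto simp: INF_less_iff)
  qed
  then obtain c r where "\<And>n. near_opt n (c n) (r n)"
    by metis
  then have
    cr: "\<And>n i. 0 \<le> r n i \<and> 2 * r n i \<le> ?d n" "\<And>n. A \<subseteq> (\<Union>i. hball (c n i) (r n i))"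
      "\<And>n. ?S (r n) < spherical_outer m A + ennreal (?d n)"
    by (auto simp only: near_opt_def)
  define B where "B = (\<Inter>n. \<Union>i. hball (c n i) (r n i))"
  have "hball p s \<in> sets borel" for p :: "'n heis" and s
    by (intro borel_closed closed_hball)
  then have "B \<in> sets borel" unfolding B_def by auto
  moreover have "A \<subseteq> B" using cr(2) by (auto simp: B_def)
  moreover have "spherical_outer m B \<le> spherical_outer m A"
    unfolding spherical_outer_def[of m B]
  proof (rule SUP_least)
    fix \<delta> :: real assume "\<delta> \<in> {0<..}"
    then have "\<delta> > 0" by simp
    have "eventually (\<lambda>n. ?d n < \<delta>) sequentially"
      using LIMSEQ_inverse_real_of_nat[THEN order_tendstoD(2), OF \<open>\<delta> > 0\<close>]
      by (simp add: inverse_eq_divide)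
    then have "eventually (\<lambda>n. spherical_premeasure m \<delta> B \<le> spherical_outer m A + ennreal (?d n))
      sequentially"
    proof eventually_elim
      case (elim n)
      have "spherical_premeasure m \<delta> B \<le> spherical_premeasure m (?d n) B"
        using elim by (intro spherical_premeasure_antimono) simp
      also have "\<dots> \<le> ?S (r n)"
        unfolding spherical_premeasure_def
        by (rule INF_lower2[of "(c n, r n)"]) (use cr(1) in \<open>auto simp: B_def\<close>)
      finally show ?case using cr(3)[of n] by simp
    qed
    moreover have "(\<lambda>n. spherical_outer m A + ennreal (?d n)) \<longlonglongrightarrow> spherical_outer m A + ennreal 0"
      using LIMSEQ_inverse_real_of_nat
      by (intro tendsto_add tendsto_const tendsto_ennrealI) (simp add: inverse_eq_divide)
    ultimately show "spherical_premeasure m \<delta> B \<le> spherical_outer m A"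
      by (intro tendsto_lowerbound[of _ "spherical_outer m A"]) auto
  qed
  ultimately show ?thesis by blast
qed

lemma space_mu [simp]: "space (mu k) = UNIV"
  by (simp add: mu_def spherical_measure_def space_measure_of_conv)

text \<open>If the set function below were not countably additive, \<open>measure_of\<close> would return the zero
  measure, for which the claim is trivial.\<close>

lemma mu_hull:
  fixes A :: "'n::finite heis set"
  assumes A: "A \<in> sets (mu k)" "emeasure (mu k) A < \<infinity>"
  shows "\<exists>B\<in>sets borel. A \<subseteq> B \<and> (\<forall>C\<in>sets (mu k). C \<subseteq> B \<longrightarrow> emeasure (mu k) C \<le> emeasure (mu k) A)"
proof -
  obtain m where m: "mu k = (spherical_measure m :: 'n heis measure)"
    unfolding mu_def by (cases "k \<le> CARD('n)") auto
  let ?L = "lambda_system UNIV (Pow UNIV) (spherical_outer m :: 'n heis set \<Rightarrow> _)"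
  show ?thesis
  proof (cases "measure_space UNIV (sigma_sets UNIV ?L) (spherical_outer m)")
    case True
    then have e: "emeasure (mu k) C = spherical_outer m C" if "C \<in> sets (mu k)" for C :: "'n heis set"
      using that unfolding m spherical_measure_def
      by (subst emeasure_measure_of_conv) (simp add: sets_measure_of_conv)
    then obtain B where B: "B \<in> sets borel" "A \<subseteq> B" "spherical_outer m B \<le> spherical_outer m A"
      using spherical_outer_hull[of m A] A by auto
    have "spherical_outer m C \<le> spherical_outer m A" if "C \<subseteq> B" for C
      using spherical_outer_mono[OF that] B(3) by (rule order_trans)
    then show ?thesis using e A(1) B(1,2) by (intro bexI[of _ B]) auto
  next
    case False
    then have "emeasure (mu k) C = 0" for C :: "'n heis set"
      unfolding m spherical_measure_def by (simp add: emeasure_measure_of_conv)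
    then show ?thesis by (intro bexI[of _ UNIV]) auto
  qed
qed

section \<open>The pairing of Rumin forms with simple integrable vectors\<close>

lemma linear_hodge: "linear hodge"
  by (auto intro!: linearI simp: hodge_def vec_eq_iff algebra_simps)

lemma simple_integrable_scale:
  assumes "v \<in> simple_integrable k"
  shows "c *\<^sub>R v \<in> simple_integrable k"
proof -
  have *: "c *\<^sub>R v \<in> horizontal_simple_integrable m" if v: "v \<in> horizontal_simple_integrable m"
    for v :: "'a mvec" and m
  proof -
    obtain d ws where "v = d *\<^sub>R wedge_list ws"
      "length ws = m" "set ws \<subseteq> horizontal_layer" "integrable_fields ws"
      using v unfolding horizontal_simple_integrable_def by auto
    then show ?thesis unfolding horizontal_simple_integrable_def by (intro CollectI exI[of _ "c * d"]) auto
  qed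
  show ?thesis
  proof (cases "k \<le> CARD('a)")
    case True
    then show ?thesis using assms * by (simp add: simple_integrable_def)
  next
    case False
    then show ?thesis using assms *
      by (auto simp: simple_integrable_def linear_scale[OF linear_hodge, symmetric])
  qed
qed

text \<open>For k \<le> n, a \<and> \<theta> has only components containing \<open>Tc\<close>, which
  horizontal products lack, and b \<and> d\<theta> pairs with v as -b does with
  \<open>Lam v\<close>, which is zero by isotropy.\<close>

lemma null_fibre_annihilates_HLambda:
  fixes c v :: "'n::finite mvec"
  assumes "c \<in> null_fibre k" "v \<in> HLambda k"
  shows "c \<bullet> v = 0"
proof (cases "k \<le> CARD('n)")
  case True
  obtain a b where c: "c = a \<and>\<^sub>w theta + b \<and>\<^sub>w dtheta"
    using assms(1) True by (auto simp: null_fibre_def)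
  have "simple_integrable k \<subseteq> {v. c \<bullet> v = 0}"
  proof
    fix v :: "'n mvec" assume "v \<in> simple_integrable k"
    then obtain d ws where "v = d *\<^sub>R wedge_list ws"
      and ws: "set ws \<subseteq> horizontal_layer" "integrable_fields ws"
      using True by (auto simp: simple_integrable_def horizontal_simple_integrable_def)
    moreover have "c \<bullet> wedge_list ws = 0"
      using Lam_wedge_list[OF integrable_fields_isotropic[OF ws(2,1)]] ws(1)
      by (simp add: c inner_add_left wedge_theta_inner wedge_dtheta_inner)
    ultimately show "v \<in> {v. c \<bullet> v = 0}" by simp
  qed
  then have "span (simple_integrable k) \<subseteq> {v. c \<bullet> v = 0}"
    by (rule span_minimal) (rule subspace_hyperplane)
  then show ?thesis using assms(2) by (auto simp: HLambda_def)
qed (use assms in \<open>simp add: null_fibre_def\<close>)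

text \<open>The comass tests simple integrable vectors, while v lies merely in their span. In a
  basis made of simple integrable vectors the coordinates are bounded on unit vectors, uniformly in
  \<omega> and p.\<close>

lemma comass_bound:
  "\<exists>C>0. \<forall>\<omega> p (v :: 'n::finite mvec).
     comass k \<omega> p \<le> 1 \<longrightarrow> v \<in> HLambda k \<longrightarrow> norm v = 1 \<longrightarrow> \<bar>pairing \<omega> p v\<bar> \<le> C"
proof -
  obtain B :: "'n mvec set" where B: "B \<subseteq> simple_integrable k" "independent B"
    "simple_integrable k \<subseteq> span B"
    using maximal_independent_subset by blast
  have finB: "finite B" using B(2) by (rule independent_imp_finite)
  have Bspan: "HLambda k \<subseteq> span B"
    using B(3) unfolding HLambda_def by (metis span_minimal subspace_span)
  have "\<exists>c. linear c \<and> (\<forall>x\<in>B. c x = (if x = b then 1 else 0 :: real))" for b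
    by (rule linear_independent_extend[OF B(2)])
  then obtain c :: "'n mvec \<Rightarrow> 'n mvec \<Rightarrow> real" where
    c: "\<And>b. linear (c b)" "\<And>b x. x \<in> B \<Longrightarrow> c b x = (if x = b then 1 else 0)"
    by metis
  have expand: "v = (\<Sum>b\<in>B. c b v *\<^sub>R b)" if "v \<in> span B" for v
  proof -
    have "linear (\<lambda>v. \<Sum>b\<in>B. c b v *\<^sub>R b)"
      by (auto intro!: linearI simp: linear_add[OF c(1)] linear_scale[OF c(1)]
          scaleR_left_distrib sum.distrib scaleR_sum_right)
    then show ?thesis
    proof (rule linear_eq_on_span[of "\<lambda>v. v", rotated, OF _ _ that])
      show "linear (\<lambda>v :: 'n mvec. v)" by (simp add: linear_ident)
      fix x assume "x \<in> B"
      then show "x = (\<Sum>b\<in>B. c b x *\<^sub>R b)"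
        using finB by (simp add: c if_distrib[of "\<lambda>t. t *\<^sub>R _"] cong: if_cong)
    qed
  qed
  have "\<exists>K. \<forall>v. \<bar>c b v\<bar> \<le> norm v * K" for b
    using linear_conv_bounded_linear[THEN iffD1, OF c(1), of b] bounded_linear.bounded by fastforce
  then obtain K where K: "\<And>b v. \<bar>c b v\<bar> \<le> norm v * K b" by metis
  \<comment> \<open>\<open>K b\<close> bounds the b-coordinate of a unit vector and the norm of b
    bounds the pairing with b; the summand 1 keeps C positive even if the sum vanishes.\<close>
  define C where "C = (\<Sum>b\<in>B. K b * norm b) + 1"
  have bound: "\<bar>pairing \<omega> p v\<bar> \<le> C"
    if co: "comass k \<omega> p \<le> 1" and v: "v \<in> HLambda k" "norm v = 1"
    for \<omega> :: "'n form set" and p v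
  proof -
    have unit: "rep \<omega> p \<bullet> w \<le> 1" if "w \<in> simple_integrable k" "norm w = 1" for w
    proof -
      have "ereal (pairing \<omega> p w) \<le> comass k \<omega> p"
        unfolding comass_def by (rule SUP_upper) (use that in auto)
      then have "ereal (pairing \<omega> p w) \<le> 1" using co by (rule order_trans)
      then show ?thesis by (simp add: pairing_def)
    qed
    have b: "\<bar>rep \<omega> p \<bullet> b\<bar> \<le> norm b" if "b \<in> B" for b
    proof (cases "b = 0")
      case False
      \<comment> \<open>The supremum in \<open>comass\<close> carries no absolute value; testing
        with both b and -b supplies it.\<close>
      have "s * (rep \<omega> p \<bullet> b) \<le> norm b" if s: "\<bar>s\<bar> = 1" for s
      proof -
        have "rep \<omega> p \<bullet> ((s / norm b) *\<^sub>R b) \<le> 1"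
          using B(1) \<open>b \<in> B\<close> False s by (intro unit simple_integrable_scale) auto
        then show ?thesis using False by (simp add: field_simps)
      qed
      from this[of 1] this[of "-1"] show ?thesis by simp
    qed simp
    have "pairing \<omega> p v = (\<Sum>b\<in>B. c b v * (rep \<omega> p \<bullet> b))"
      unfolding pairing_def by (subst expand[of v]) (use v Bspan in \<open>auto simp: inner_sum_right\<close>)
    also have "\<bar>\<dots>\<bar> \<le> (\<Sum>b\<in>B. K b * norm b)"
    proof (rule order_trans[OF sum_abs sum_mono])
      fix b assume "b \<in> B"
      then show "\<bar>c b v * (rep \<omega> p \<bullet> b)\<bar> \<le> K b * norm b"
        unfolding abs_mult using K[of b v] v b by (intro mult_mono) auto
    qed
    finally show ?thesis by (simp add: C_def)
  qed
  have "0 \<le> K b" for b :: "'n mvec"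
    using order_trans[OF abs_ge_zero K[of b ext_one]] by (simp add: ext_one_def)
  then have "0 \<le> (\<Sum>b\<in>B. K b * norm b)" by (auto intro!: sum_nonneg mult_nonneg_nonneg)
  then have "C > 0" by (simp add: C_def)
  then show ?thesis using bound by blast
qed

section \<open>Cutting off test forms\<close>

lemma zero_in_forms: "(\<lambda>p. 0) \<in> forms k U"
  by (simp add: forms_def smooth_on_iff_Cn Cn_on_const homog_def)

lemma self_in_rumin_class: "\<alpha> \<in> rumin_reps k U \<Longrightarrow> \<alpha> \<in> rumin_class k U \<alpha>"
  using zero_in_forms
  by (auto simp: rumin_class_def rumin_null_def ideal_forms_def linear_0[OF linear_wedge(2)]
      intro!: bexI[of _ "\<lambda>p. 0"])

lemma rumin_null_fibre: "\<gamma> \<in> rumin_null k U \<Longrightarrow> p \<in> U \<Longrightarrow> \<gamma> p \<in> null_fibre k"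
  unfolding rumin_null_def ideal_forms_def forms_def null_fibre_def
  by (auto split: if_splits) blast

lemma rep_rumin_class:
  assumes "\<alpha> \<in> rumin_reps k U"
  shows "rep (rumin_class k U \<alpha>) \<in> rumin_reps k U"
    and "p \<in> U \<Longrightarrow> rep (rumin_class k U \<alpha>) p - \<alpha> p \<in> null_fibre k"
proof -
  have r: "rep (rumin_class k U \<alpha>) \<in> rumin_class k U \<alpha>"
    unfolding rep_def
    by (rule someI[of "\<lambda>\<beta>. \<beta> \<in> rumin_class k U \<alpha>", OF self_in_rumin_class[OF assms]])
  then show "rep (rumin_class k U \<alpha>) \<in> rumin_reps k U" by (simp add: rumin_class_def)
  assume "p \<in> U"
  with r show "rep (rumin_class k U \<alpha>) p - \<alpha> p \<in> null_fibre k"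
    unfolding rumin_class_def using rumin_null_fibre by fastforce
qed

text \<open>Multiplication by a function commutes with the wedge products that cut out J^k.\<close>

lemma scale_rumin_reps:
  fixes f :: "'n::finite heis \<Rightarrow> real"
  assumes "open U" "\<And>n. Cn_on n U f" "\<alpha> \<in> rumin_reps k U"
  shows "(\<lambda>p. f p *\<^sub>R \<alpha> p) \<in> rumin_reps k U"
proof -
  have "(\<lambda>p. f p *\<^sub>R \<alpha> p) \<in> forms m U" if "\<alpha> \<in> forms m U" for m
    using that assms(1,2) by (auto simp: forms_def smooth_on_iff_Cn homog_def intro: Cn_on_scaleR)
  then show ?thesis using assms(3)
    by (auto simp: rumin_reps_def J_forms_def linear_scale[OF linear_wedge(2)] split: if_splits)
qed

text \<open>The new form is the class of f times the representative of \<omega>. Whatever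
  representative \<open>rep\<close> picks from it differs from this product by a null fibre element,
  which neither the support nor the pairing with \<open>HLambda\<close> detects.\<close>

lemma cutoff_test_form:
  fixes f :: "'n::finite heis \<Rightarrow> real"
  assumes U: "open U" and \<omega>: "\<omega> \<in> test_forms k U" and f: "\<And>n. Cn_on n U f"
    and K: "compact K" "K \<subseteq> U" "\<And>p. p \<notin> K \<Longrightarrow> f p = 0"
  obtains \<omega>' where "\<omega>' \<in> test_forms k U" "form_spt k U \<omega>' \<subseteq> K"
    "\<And>p v. p \<in> U \<Longrightarrow> v \<in> HLambda k \<Longrightarrow> pairing \<omega>' p v = f p * pairing \<omega> p v"
proof -
  have "rep \<omega> \<in> rumin_reps k U" using \<omega> rep_rumin_class(1) by (auto simp: test_forms_def)
  then have r: "(\<lambda>p. f p *\<^sub>R rep \<omega> p) \<in> rumin_reps k U" by (rule scale_rumin_reps[OF U f])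
  define \<omega>' where "\<omega>' = rumin_class k U (\<lambda>p. f p *\<^sub>R rep \<omega> p)"
  have diff: "rep \<omega>' p - f p *\<^sub>R rep \<omega> p \<in> null_fibre k" if "p \<in> U" for p
    unfolding \<omega>'_def using rep_rumin_class(2)[OF r that] .
  have "{p\<in>U. rep \<omega>' p \<notin> null_fibre k} \<subseteq> K"
    using diff K(3) by fastforce
  then have cl: "closure {p\<in>U. rep \<omega>' p \<notin> null_fibre k} \<subseteq> K"
    using K(1) by (intro closure_minimal compact_imp_closed)
  then have spt: "form_spt k U \<omega>' = closure {p\<in>U. rep \<omega>' p \<notin> null_fibre k}"
    using K(2) by (auto simp: form_spt_def)
  have "compact (K \<inter> form_spt k U \<omega>')"
    unfolding spt using K(1) by (intro compact_Int_closed closed_closure)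
  moreover have "K \<inter> form_spt k U \<omega>' = form_spt k U \<omega>'" using cl spt by auto
  ultimately have "compact (form_spt k U \<omega>')" by simp
  then have "\<omega>' \<in> test_forms k U" using r by (auto simp: test_forms_def \<omega>'_def)
  moreover have "pairing \<omega>' p v = f p * pairing \<omega> p v" if "p \<in> U" "v \<in> HLambda k" for p v
    using null_fibre_annihilates_HLambda[OF diff[OF that(1)] that(2)]
    by (simp add: pairing_def inner_diff_left)
  ultimately show ?thesis using that cl spt by blast
qed

section \<open>Finiteness of the mass\<close>

text \<open>On an open set where T vanishes the density is orthogonal to every bump of a box inside
  a fixed closed box, hence zero almost everywhere on the open one. Countably many boxes cover S
  outside spt T, so the exceptional sets remain null together.\<close>

lemma rectifiable_integrand_eq_0_off_spt:
  fixes U :: "'n::finite heis set"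
  assumes U: "open U" and SU: "S \<subseteq> U" and Sfin: "emeasure (mu k) S < \<infinity>" and S: "S \<in> sets (mu k)"
    and \<tau>: "AE p in mu k. p \<in> S \<longrightarrow> \<tau> p \<in> HLambda k"
    and T: "\<And>\<omega>. \<omega> \<in> test_forms k U \<Longrightarrow> has_bochner_integral (mu k)
               (\<lambda>p. indicator S p * (pairing \<omega> p (\<tau> p) * \<rho> p)) (T \<omega>)"
    and \<omega>: "\<omega> \<in> test_forms k U"
  shows "AE p in mu k. p \<in> S - current_spt k U T \<longrightarrow> pairing \<omega> p (\<tau> p) * \<rho> p = 0"
proof -
  let ?h = "\<lambda>\<omega> p. indicator S p * (pairing \<omega> p (\<tau> p) * \<rho> p)"
  obtain N where N: "{p\<in>space (mu k). \<not> (p \<in> S \<longrightarrow> \<tau> p \<in> HLambda k)} \<subseteq> N"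
    "emeasure (mu k) N = 0" "N \<in> sets (mu k)"
    using \<tau> by (rule AE_E)
  have cN: "- N \<in> sets (mu k)" using sets.compl_sets[OF N(3)] by (simp add: Compl_eq_Diff_UNIV)
  have AEN: "AE p in mu k. p \<notin> N" using N by (intro AE_not_in) auto
  \<comment> \<open>Discarding a measurable null set that contains the points of S with \<tau>
    outside \<open>HLambda\<close> makes the cut-off identity hold at every point, so the integrands
    agree as functions.\<close>
  define g where "g p = indicator (- N) p * ?h \<omega> p" for p
  have intN: "has_bochner_integral (mu k) (\<lambda>p. indicator (- N) p * ?h \<eta> p) (T \<eta>)"
    if "\<eta> \<in> test_forms k U" for \<eta>
  proof -
    have h: "integrable (mu k) (?h \<eta>)" and e: "integral\<^sup>L (mu k) (?h \<eta>) = T \<eta>"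
      using T[OF that] by (auto simp: has_bochner_integral_iff)
    have i: "integrable (mu k) (\<lambda>p. indicator (- N) p * ?h \<eta> p)"
      using integrable_mult_indicator[OF cN h] by simp
    have "integral\<^sup>L (mu k) (\<lambda>p. indicator (- N) p * ?h \<eta> p) = integral\<^sup>L (mu k) (?h \<eta>)"
      using i h AEN by (intro integral_cong_AE borel_measurable_integrable) (auto elim!: eventually_mono)
    then show ?thesis using i e by (simp add: has_bochner_integral_iff)
  qed
  have box: "AE p in mu k. p \<in> box a0 b0 \<longrightarrow> g p = 0"
    if V: "V \<subseteq> U" "\<forall>\<omega>\<in>test_forms k U. form_spt k U \<omega> \<subseteq> V \<longrightarrow> T \<omega> = 0" and ab: "cbox a0 b0 \<subseteq> V"
    for V and a0 b0 :: "'n heis"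
  proof (rule AE_eq_0_of_box_approx[where \<psi>=box_bump])
    show "integrable (mu k) g" using intN[OF \<omega>] by (simp add: has_bochner_integral_iff g_def[abs_def])
    \<comment> \<open>g vanishes off S, so the finite measure of the carrier supplies the finiteness
      needed for the hull.\<close>
    have "emeasure (mu k) {p. g p \<noteq> 0} \<le> emeasure (mu k) S"
      using S by (intro emeasure_mono) (auto simp: g_def indicator_def split: if_splits)
    then show "emeasure (mu k) {p. g p \<noteq> 0} < \<infinity>" using Sfin by (rule le_less_trans)
    fix a b :: "'n heis" and n assume sub: "box a b \<subseteq> box a0 b0"
    have zero: "box_bump a b n p = 0" if "p \<notin> cbox a0 b0" for p
      using that sub box_subset_cbox by (intro box_bump_eq_0) blast
    obtain \<omega>' where \<omega>': "\<omega>' \<in> test_forms k U" "form_spt k U \<omega>' \<subseteq> cbox a0 b0"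
      "\<And>p v. p \<in> U \<Longrightarrow> v \<in> HLambda k \<Longrightarrow> pairing \<omega>' p v = box_bump a b n p * pairing \<omega> p v"
      using cutoff_test_form[OF U \<omega> Cn_on_box_bump[OF U] compact_cbox _ zero] V ab by blast
    have "T \<omega>' = 0" using V(2) \<omega>' ab by blast
    moreover have "(\<lambda>p. indicator (- N) p * ?h \<omega>' p) = (\<lambda>p. box_bump a b n p * g p)"
    proof
      fix p
      show "indicator (- N) p * ?h \<omega>' p = box_bump a b n p * g p"
      proof (cases "p \<in> S \<and> p \<notin> N")
        case True
        then have "\<tau> p \<in> HLambda k" using N(1) by auto
        then show ?thesis using \<omega>'(3)[of p "\<tau> p"] True SU by (auto simp: g_def)
      qed (auto simp: g_def)
    qed
    ultimately show "has_bochner_integral (mu k) (\<lambda>p. box_bump a b n p * g p) 0"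
      using intN[OF \<omega>'(1)] by simp
  qed (use mu_hull box_bump_bounds box_bump_tendsto in auto)
  define VV where "VV = {V. open V \<and> V \<subseteq> U \<and> (\<forall>\<omega>\<in>test_forms k U. form_spt k U \<omega> \<subseteq> V \<longrightarrow> T \<omega> = 0)}"
  define BB where "BB = {box a b |a b. \<exists>V\<in>VV. cbox a b \<subseteq> V}"
  have "\<exists>X\<in>BB. p \<in> X" if p: "p \<in> S - current_spt k U T" for p
  proof -
    have "p \<in> \<Union>VV" using p SU unfolding current_spt_def VV_def by blast
    then obtain V where V: "V \<in> VV" "p \<in> V" by blast
    then have "open V" by (simp add: VV_def)
    then obtain a b where "cbox a b \<subseteq> V" "p \<in> box a b"
      using V(2) open_contains_cbox by metis
    then show ?thesis using V(1) unfolding BB_def by blast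
  qed
  moreover have "\<And>X. X \<in> BB \<Longrightarrow> open X" by (auto simp: BB_def)
  \<comment> \<open>The open sets on which T vanishes may be uncountably many; Lindelof's theorem
    leaves countably many boxes.\<close>
  then obtain BB' where BB': "BB' \<subseteq> BB" "countable BB'" "\<Union>BB' = \<Union>BB"
    using Lindelof by metis
  ultimately have cover: "\<exists>X\<in>BB'. p \<in> X" if "p \<in> S - current_spt k U T" for p
    using that by blast
  have "AE p in mu k. p \<in> X \<longrightarrow> g p = 0" if "X \<in> BB'" for X
    using that BB'(1) box unfolding BB_def VV_def by blast
  then have "AE p in mu k. \<forall>X\<in>BB'. p \<in> X \<longrightarrow> g p = 0"
    using AE_ball_countable[OF BB'(2), of "\<lambda>p X. p \<in> X \<longrightarrow> g p = 0"] by blast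
  then show ?thesis using AEN
  proof eventually_elim
    case (elim p)
    show ?case
    proof
      assume p: "p \<in> S - current_spt k U T"
      then have "g p = 0" using cover elim(1) by blast
      then show "pairing \<omega> p (\<tau> p) * \<rho> p = 0" using p elim(2) by (simp add: g_def)
    qed
  qed
qed

text \<open>Unit length is part of \<open>unit_tangent\<close>, and the oriented pieces exhaust S up
  to a null set.\<close>

lemma orients_AE_norm:
  assumes "orients k S \<tau>"
  shows "AE p in mu k. p \<in> S \<longrightarrow> norm (\<tau> p) = 1"
proof -
  obtain Sj B t where *: "\<And>j. surface_orientation k (Sj j) (t j)" "\<And>j. B j \<subseteq> Sj j"
    "\<And>j p. p \<in> B j \<Longrightarrow> \<tau> p = t j p"
    "(S - (\<Union>j :: nat. B j)) \<union> ((\<Union>j. B j) - S) \<in> null_sets (mu k)"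
    using assms unfolding orients_def by blast
  from AE_not_in[OF *(4)] show ?thesis
  proof eventually_elim
    case (elim p)
    show ?case
    proof
      assume "p \<in> S"
      then obtain j where j: "p \<in> B j" using elim by auto
      then have "unit_tangent k (Sj j) p (t j p)"
        using *(1,2)[of j] by (auto simp: surface_orientation_def)
      then show "norm (\<tau> p) = 1" using *(3)[OF j] by (simp add: unit_tangent_def)
    qed
  qed
qed

lemma mass_rectifiable_finite_pos:
  fixes U :: "'n::finite heis set"
  assumes U: "open U" and k: "k \<noteq> 0" and T: "T \<in> rectifiable_currents k U"
  shows "mass k U T < \<infinity>"
proof -
  obtain S \<tau> and \<rho> :: "'n heis \<Rightarrow> nat" where SU: "S \<subseteq> U" and rect: "H_rectifiable k S"
    and or: "orients k S \<tau>" and \<tau>: "AE p in mu k. p \<in> S \<longrightarrow> \<tau> p \<in> HLambda k"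
    and int: "\<And>\<omega>. \<omega>\<in>test_forms k U \<Longrightarrow> has_bochner_integral (mu k)
               (\<lambda>p. indicator S p * (pairing \<omega> p (\<tau> p) * real (\<rho> p))) (T \<omega>)"
    and fin: "(\<integral>\<^sup>+ p \<in> S \<inter> current_spt k U T. ennreal (real (\<rho> p)) \<partial>mu k) < \<infinity>"
    using T k by (simp add: rectifiable_currents_def) blast
  obtain C where C: "C > 0" "\<And>\<omega> p (v :: 'n mvec).
      comass k \<omega> p \<le> 1 \<Longrightarrow> v \<in> HLambda k \<Longrightarrow> norm v = 1 \<Longrightarrow> \<bar>pairing \<omega> p v\<bar> \<le> C"
    using comass_bound by metis
  define I where "I = (\<integral>\<^sup>+ p \<in> S \<inter> current_spt k U T. ennreal (real (\<rho> p)) \<partial>mu k)"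
  have bound: "T \<omega> \<le> C * enn2real I"
    if \<omega>: "\<omega> \<in> test_forms k U" and co: "\<forall>p\<in>U. comass k \<omega> p \<le> 1" for \<omega>
  proof -
    let ?h = "\<lambda>p. indicator S p * (pairing \<omega> p (\<tau> p) * real (\<rho> p))"
    have h: "integrable (mu k) ?h" "integral\<^sup>L (mu k) ?h = T \<omega>"
      using int[OF \<omega>] by (auto simp: has_bochner_integral_iff)
    have "AE p in mu k. p \<in> S - current_spt k U T \<longrightarrow> pairing \<omega> p (\<tau> p) * real (\<rho> p) = 0"
      using rect by (intro rectifiable_integrand_eq_0_off_spt[OF U SU _ _ \<tau> int \<omega>])
        (auto simp: H_rectifiable_def)
    \<comment> \<open>The constant divides the integrable side instead of multiplying \<rho>:
      monotonicity of the nonnegative integral then suffices, without measurability of S \<inter>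
      spt T.\<close>
    with \<tau> orients_AE_norm[OF or]
    have "AE p in mu k. ennreal (\<bar>?h p\<bar> / C)
        \<le> ennreal (real (\<rho> p)) * indicator (S \<inter> current_spt k U T) p"
    proof eventually_elim
      case (elim p)
      show ?case
      proof (cases "p \<in> S \<inter> current_spt k U T")
        case True
        then have "\<bar>pairing \<omega> p (\<tau> p)\<bar> \<le> C" using elim SU co by (intro C(2)) auto
        then have "\<bar>pairing \<omega> p (\<tau> p)\<bar> * real (\<rho> p) \<le> C * real (\<rho> p)"
          by (rule mult_right_mono) simp
        then have "\<bar>?h p\<bar> / C \<le> real (\<rho> p)"
          using True C(1) by (simp add: abs_mult pos_divide_le_eq mult.commute)
        then show ?thesis using True by (simp add: ennreal_leI)
      next
        case False
        then have "?h p = 0" using elim by (auto simp: indicator_def)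
        then show ?thesis by (simp only: abs_zero div_0 ennreal_0 zero_le)
      qed
    qed
    then have "(\<integral>\<^sup>+ p. ennreal (\<bar>?h p\<bar> / C) \<partial>mu k) \<le> I"
      unfolding I_def by (rule nn_integral_mono_AE)
    moreover have "(\<integral>\<^sup>+ p. ennreal (\<bar>?h p\<bar> / C) \<partial>mu k) = ennreal (\<integral> p. \<bar>?h p\<bar> / C \<partial>mu k)"
      using h C(1) by (intro nn_integral_eq_integral) auto
    ultimately have "ennreal ((\<integral> p. \<bar>?h p\<bar> \<partial>mu k) / C) \<le> ennreal (enn2real I)"
      using fin by (simp add: I_def)
    then have "(\<integral> p. \<bar>?h p\<bar> \<partial>mu k) / C \<le> enn2real I"
      by (simp add: ennreal_le_iff)
    then have "(\<integral> p. \<bar>?h p\<bar> \<partial>mu k) \<le> C * enn2real I"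
      using C(1) by (simp add: field_simps)
    moreover have "T \<omega> \<le> (\<integral> p. \<bar>?h p\<bar> \<partial>mu k)"
      using integral_abs_bound[of "mu k" ?h] h by linarith
    ultimately show ?thesis by linarith
  qed
  have "mass k U T \<le> ereal (C * enn2real I)"
    unfolding mass_def by (rule SUP_least) (use bound in auto)
  then show ?thesis by (rule le_less_trans) simp
qed

text \<open>The empty list has rank 0, and a constant map on {0} is its integral manifold. This lets
  the comass in degree 0 control point evaluations.\<close>

lemma ext_one_simple_integrable: "ext_one \<in> simple_integrable 0"
proof -
  have "integrable_fields ([] :: 'a heis list)"
    unfolding integrable_fields_def
  proof (intro allI)
    fix p :: "'a heis"
    have "smooth_on UNIV (\<lambda>_ :: real ^ 'a. p)" by (simp add: smooth_on_iff_Cn Cn_on_const)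
    then show "\<exists>(E :: (real ^ 'a) set) Q \<phi> u0. subspace E \<and> dim E = dim (span (set ([] :: 'a heis list)))
      \<and> open Q \<and> smooth_on Q \<phi> \<and> u0 \<in> E \<inter> Q \<and> \<phi> u0 = p \<and>
      (\<forall>u\<in>E \<inter> Q. frechet_derivative \<phi> (at u) ` E = (\<lambda>w. left_field w (\<phi> u)) ` span (set []))"
      by (intro exI[of _ "{0}"] exI[of _ UNIV] exI[of _ "\<lambda>_. p"] exI[of _ 0])
         (auto simp: left_field_def)
  qed
  then show ?thesis
    by (auto simp: simple_integrable_def horizontal_simple_integrable_def
        intro!: exI[of _ 1] exI[of _ "[] :: 'a heis list"])
qed

text \<open>The sum of the |c p|, times the comass constant, bounds the mass. This is the case of
  boundaries for k = 1.\<close>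

lemma mass_rectifiable_finite_zero:
  fixes U :: "'n::finite heis set"
  assumes "T \<in> rectifiable_currents 0 U"
  shows "mass 0 U T < \<infinity>"
proof -
  obtain F and c :: "'n heis \<Rightarrow> int" where F: "finite F" "F \<subseteq> U"
    and T: "\<And>\<omega>. \<omega> \<in> test_forms 0 U \<Longrightarrow> T \<omega> = (\<Sum>p\<in>F. of_int (c p) * pairing \<omega> p ext_one)"
    using assms unfolding rectifiable_currents_def by auto
  have "ext_one \<in> HLambda 0"
    using ext_one_simple_integrable by (auto simp: HLambda_def intro: span_base)
  moreover have "norm (ext_one :: 'n mvec) = 1" by (simp add: ext_one_def)
  ultimately obtain C where C: "\<And>\<omega> (p :: 'n heis). comass 0 \<omega> p \<le> 1 \<Longrightarrow> \<bar>pairing \<omega> p ext_one\<bar> \<le> C"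
    using comass_bound by metis
  have "mass 0 U T \<le> ereal (\<Sum>p\<in>F. \<bar>of_int (c p)\<bar> * C)"
    unfolding mass_def
  proof (rule SUP_least)
    fix \<omega> assume "\<omega> \<in> {\<omega> \<in> test_forms 0 U. \<forall>p\<in>U. comass 0 \<omega> p \<le> 1}"
    then have \<omega>: "\<omega> \<in> test_forms 0 U" "\<forall>p\<in>U. comass 0 \<omega> p \<le> 1" by auto
    have "of_int (c p) * pairing \<omega> p ext_one \<le> \<bar>of_int (c p)\<bar> * C" if "p \<in> F" for p
    proof -
      have "of_int (c p) * pairing \<omega> p ext_one \<le> \<bar>of_int (c p)\<bar> * \<bar>pairing \<omega> p ext_one\<bar>"
        unfolding abs_mult[symmetric] by (rule abs_ge_self)
      also have "\<dots> \<le> \<bar>of_int (c p)\<bar> * C"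
        using that F \<omega> by (intro mult_left_mono C) auto
      finally show ?thesis .
    qed
    then show "ereal (T \<omega>) \<le> ereal (\<Sum>p\<in>F. \<bar>of_int (c p)\<bar> * C)"
      using T[OF \<omega>(1)] by (auto intro: sum_mono)
  qed
  then show ?thesis by (rule le_less_trans) simp
qed

theorem proposition2p16:
  fixes U :: "'n::finite heis set" and k :: nat
  assumes "open U" and "1 \<le> k" and "k \<le> 2 * CARD('n) + 1"
  shows "(\<forall>T\<in>rectifiable_currents k U. mass k U T < \<infinity>) \<and>
    rectifiable_currents k U \<subseteq> finite_mass_currents k U \<and>
    integral_currents k U \<subseteq> normal_currents k U"
proof -
  have fin: "mass m U T < \<infinity>" if "T \<in> rectifiable_currents m U" for m T
    using that assms(1) mass_rectifiable_finite_pos mass_rectifiable_finite_zero by metis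
  moreover have "rectifiable_currents k U \<subseteq> compact_currents k U"
    using assms(2) by (auto simp: rectifiable_currents_def)
  ultimately show ?thesis
    by (auto simp: finite_mass_currents_def integral_currents_def normal_currents_def
        dest: fin)
qed

end
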